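(* Let $Q$ be a Markov transition kernel on $(\mathsf X,\mathcal X)$, let $g:\mathsf X\times\mathsf Y\to[0,\infty)$ be the likelihood, and let $\{Y_k\}_{k\ge 0}$ be a stochastic process on a measurable space $(\Omega,\mathcal A)$ with values in $(\mathsf Y,\mathcal Y)$ (not necessarily the observation process of a hidden Markov model). Let $\mathbb P_\star$ be a probability measure on $(\Omega,\mathcal A)$. Assume: (a) $g(x,y)>0$ for all $(x,y)\in\mathsf X\times\mathsf Y$; (b) there are a set $\mathsf K\subseteq\mathsf Y$ and a function $V:\mathsf X\to[1,\infty)$ such that for every $\eta>0$ there is an LD-set $\mathsf C\in\mathcal X$ with $\Upsilon_{\mathsf C^c}(y)\le\eta\,\Upsilon_{\mathsf X}(y)$ for all $y\in\mathsf K$. Assume in addition that for some LD-set $\mathsf D$ and some constants $M>0$ and $\gamma\in(0,1)$, the following hold $\mathbb P_\star$-almost surely: $$\liminf_{n\to\infty} n^{-1}\sum_{i=0}^n \mathbf 1_{\mathsf K}(Y_i)\ge\frac{1+\gamma}{2},$$ $$\limsup_{n\to\infty} n^{-1}\sum_{i=0}^n\log\Upsilon_{\mathsf X}(Y_i)<M,$$ $$\liminf_{n\to\infty} n^{-1}\sum_{i=2}^n\log\Psi_{\mathsf D}(Y_i)>-M .$$ Then, for any probability measures $\nu$ and $\nu'$ on $(\mathsf X,\mathcal X)$ such that $\nu(V)+\nu'(V)<\infty$, $\nu Q\mathbf 1_{\mathsf D}>0$ and $\nu' Q\mathbf 1_{\mathsf D}>0$, there exists a positive constant $c$ such that $$\limsup_{n\to\infty}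 n^{-1}\log\left\|\phi_{\nu,n}[Y_{0:n}]-\phi_{\nu',n}[Y_{0:n}]\right\|_{\mathrm{TV}}<-c,\qquad \mathbb P_\star\text{-a.s.}$$
   Context: $\mathsf X$ and $\mathsf Y$ are spaces equipped with countably generated $\sigma$-fields $\mathcal X$ and $\mathcal Y$. There are a transition kernel $G$ from $(\mathsf X,\mathcal X)$ to $(\mathsf Y,\mathcal Y)$ and a measure $\mu$ on $(\mathsf Y,\mathcal Y)$ such that $G(x,\cdot)$ is absolutely continuous with respect to $\mu$ for every $x$, and $g(x,\cdot)=dG(x,\cdot)/d\mu$ is the likelihood (jointly measurable). For a non-negative measurable $f$, $Qf(x)=Q(x,f)=\int Q(x,dx')f(x')$, and $\nu(f)=\int f\,d\nu$; $\nu Q\mathbf 1_{\mathsf D}=\int\nu(dx)Q(x,\mathsf D)$. Functions such as $V$ are measurable. Filtering distribution: for a probability measure $\nu$ on $(\mathsf X,\mathcal X)$, $y_{0:n}=[y_0,\dots,y_n]\in\mathsf Y^{n+1}$ and $A\in\mathcal X$, $$\phi_{\nu,n}[y_{0:n}](A)=\frac{\int_{\mathsf X^{n+1}}\nu(dx_0)g(x_0,y_0)\prod_{i=1}^nQ(x_{i-1},dx_i)g(x_i,y_i)\,\mathbf 1_A(x_n)}{\int_{\mathsf X^{n+1}}\nu(dx_0)g(x_0,y_0)\prod_{i=1}^nQ(x_{i-1},dx_i)g(x_i,y_i)}.$$ Total variation: for probability measures, $\|\phi-\phi'\|_{\mathrm{TV}}=\sup_{A\in\mathcal X}|\phi(A)-\phi'(A)|$.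 LD-set (local Doeblin set): $\mathsf C\in\mathcal X$ is an LD-set if there are a measure $\lambda_{\mathsf C}$ and constants $\epsilon^-_{\mathsf C}>0$, $\epsilon^+_{\mathsf C}>0$ with $\lambda_{\mathsf C}(\mathsf C)>0$ and, for all $A\in\mathcal X$ and $x\in\mathsf C$, $\epsilon^-_{\mathsf C}\lambda_{\mathsf C}(A\cap\mathsf C)\le Q(x,A\cap\mathsf C)\le\epsilon^+_{\mathsf C}\lambda_{\mathsf C}(A\cap\mathsf C)$. Each LD-set is considered together with such a choice of $\lambda_{\mathsf C},\epsilon^\pm_{\mathsf C}$. For $\mathsf A\in\mathcal X$, $\Upsilon_{\mathsf A}(y)=\sup_{x\in\mathsf A}g(x,y)\,QV(x)/V(x)$ (with $\sup\emptyset=0$). For an LD-set $\mathsf D$, $\Psi_{\mathsf D}(y)=\lambda_{\mathsf D}(g(\cdot,y)\mathbf 1_{\mathsf D})=\int_{\mathsf D}g(x,y)\lambda_{\mathsf D}(dx)$. *)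

theory Defs
  imports "HOL-Probability.Probability"
begin

definition countably_generated :: "'a measure \<Rightarrow> bool" where
  "countably_generated M \<longleftrightarrow>
     (\<exists>E. countable E \<and> E \<subseteq> Pow (space M) \<and> sets M = sigma_sets (space M) E)"

(* A kernel in the general sense: the measures need not be normalised.  Markov kernels are the
   elements of  measurable M (prob_algebra N). *)
definition transition_kernel :: "'a measure \<Rightarrow> 'b measure \<Rightarrow> ('a \<Rightarrow> 'b measure) \<Rightarrow> bool" where
  "transition_kernel M N G \<longleftrightarrow>
     (\<forall>x\<in>space M. sets (G x) = sets N) \<and>
     (\<forall>B\<in>sets N. (\<lambda>x. emeasure (G x) B) \<in> borel_measurable M)"

(* Extended logarithm, with log 0 = -infinity and log infinity = infinity. *)
definition elog :: "ennreal \<Rightarrow> ereal" where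
  "elog x = (if x = 0 then -\<infinity> else if x = top then \<infinity> else ereal (ln (enn2real x)))"

definition tv_dist :: "'a measure \<Rightarrow> 'a measure \<Rightarrow> ennreal" where
  "tv_dist M N = (SUP A\<in>sets M. ennreal \<bar>measure M A - measure N A\<bar>)"

(* The iterated integral
     int nu(dx_0) g(x_0,y_0) int Q(x_0,dx_1) g(x_1,y_1) ... int Q(x_(n-1),dx_n) g(x_n,y_n) f(x_n).
   The observations y_0,...,y_n are the first n + 1 terms of the sequence y. *)
primrec path_integral ::
  "('x \<Rightarrow> 'x measure) \<Rightarrow> ('x \<Rightarrow> 'y \<Rightarrow> real) \<Rightarrow> nat \<Rightarrow> (nat \<Rightarrow> 'y) \<Rightarrow> ('x \<Rightarrow> ennreal) \<Rightarrow> 'x measure \<Rightarrow> ennreal"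
where
  "path_integral Q g 0 y f \<nu> = (\<integral>\<^sup>+ x. ennreal (g x (y 0)) * f x \<partial>\<nu>)"
| "path_integral Q g (Suc n) y f \<nu> =
     (\<integral>\<^sup>+ x. ennreal (g x (y 0)) * path_integral Q g n (\<lambda>i. y (Suc i)) f (Q x) \<partial>\<nu>)"

(* The set function below is countably additive, see emeasure_filtering_dist.  The convention for
   division by 0 or infinity only matters when the normalising constant is 0 or infinite. *)
definition filtering_dist ::
  "('x \<Rightarrow> 'x measure) \<Rightarrow> ('x \<Rightarrow> 'y \<Rightarrow> real) \<Rightarrow> 'x measure \<Rightarrow> nat \<Rightarrow> (nat \<Rightarrow> 'y) \<Rightarrow> 'x measure"
where
  "filtering_dist Q g \<nu> n y =
     measure_of (space \<nu>) (sets \<nu>)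
       (\<lambda>A. path_integral Q g n y (indicator A) \<nu> / path_integral Q g n y (\<lambda>_. 1) \<nu>)"

definition LD_set_with ::
  "'x measure \<Rightarrow> ('x \<Rightarrow> 'x measure) \<Rightarrow> 'x set \<Rightarrow> 'x measure \<Rightarrow> real \<Rightarrow> real \<Rightarrow> bool"
where
  "LD_set_with X Q C \<Lambda> \<epsilon>m \<epsilon>p \<longleftrightarrow>
     C \<in> sets X \<and> sets \<Lambda> = sets X \<and> \<epsilon>m > 0 \<and> \<epsilon>p > 0 \<and> emeasure \<Lambda> C > 0 \<and>
     (\<forall>A\<in>sets X. \<forall>x\<in>C.
        ennreal \<epsilon>m * emeasure \<Lambda> (A \<inter> C) \<le> emeasure (Q x) (A \<inter> C) \<and>
        emeasure (Q x) (A \<inter> C) \<le> ennreal \<epsilon>p * emeasure \<Lambda> (A \<inter> C))"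

definition LD_set :: "'x measure \<Rightarrow> ('x \<Rightarrow> 'x measure) \<Rightarrow> 'x set \<Rightarrow> bool" where
  "LD_set X Q C \<longleftrightarrow> (\<exists>\<Lambda> \<epsilon>m \<epsilon>p. LD_set_with X Q C \<Lambda> \<epsilon>m \<epsilon>p)"

definition Upsilon ::
  "('x \<Rightarrow> 'x measure) \<Rightarrow> ('x \<Rightarrow> 'y \<Rightarrow> real) \<Rightarrow> ('x \<Rightarrow> real) \<Rightarrow> 'x set \<Rightarrow> 'y \<Rightarrow> ennreal"
where
  "Upsilon Q g V A y =
     (SUP x\<in>A. ennreal (g x y) * (\<integral>\<^sup>+ x'. ennreal (V x') \<partial>Q x) / ennreal (V x))"

definition Psi :: "('x \<Rightarrow> 'y \<Rightarrow> real) \<Rightarrow> 'x measure \<Rightarrow> 'x set \<Rightarrow> 'y \<Rightarrow> ennreal" where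
  "Psi g \<Lambda> D y = (\<integral>\<^sup>+ x\<in>D. ennreal (g x y) \<partial>\<Lambda>)"

context
  fixes X :: "'x measure" and Y :: "'y measure"
    and Q :: "'x \<Rightarrow> 'x measure" and g :: "'x \<Rightarrow> 'y \<Rightarrow> real"
  assumes Q: "Q \<in> measurable X (prob_algebra X)"
    and g: "case_prod g \<in> borel_measurable (X \<Otimes>\<^sub>M Y)"
begin

lemma measurable_g_section:
  assumes "z \<in> space Y" shows "(\<lambda>x. g x z) \<in> borel_measurable X"
  using measurable_compose[OF measurable_Pair2'[OF assms] g] by simp

lemma measurable_path_integral:
  assumes "f \<in> borel_measurable X" "\<And>i. y i \<in> space Y"
  shows "(\<lambda>x. path_integral Q g n y f (Q x)) \<in> borel_measurable X"
  using assms(2)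
proof (induction n arbitrary: y)
  note Q' = measurable_prob_algebraD[OF Q]
  note [measurable] = assms(1)
  case 0
  note [measurable] = measurable_g_section[OF 0[of 0]]
  show ?case
    unfolding path_integral.simps
    by (rule measurable_compose[OF Q' nn_integral_measurable_subprob_algebra]) measurable
next
  note Q' = measurable_prob_algebraD[OF Q]
  case (Suc n)
  note [measurable] = measurable_g_section[OF Suc.prems[of 0]] Suc.IH[OF Suc.prems]
  show ?case
    unfolding path_integral.simps
    by (rule measurable_compose[OF Q' nn_integral_measurable_subprob_algebra]) measurable
qed

lemma path_integral_suminf:
  assumes f: "\<And>k. f k \<in> borel_measurable X" and "\<And>i. y i \<in> space Y" and "sets \<nu> = sets X"
  shows "path_integral Q g n y (\<lambda>x. \<Sum>k. f k x) \<nu> = (\<Sum>k. path_integral Q g n y (f k) \<nu>)"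
  using assms(2,3)
proof (induction n arbitrary: y \<nu>)
  case 0
  note [measurable] = f measurable_g_section[OF 0(1)[of 0]]
  have [measurable_cong]: "sets \<nu> = sets X" by fact
  show ?case
    by (subst (2) path_integral.simps, subst nn_integral_suminf[symmetric]) (auto simp: ennreal_suminf_cmult)
next
  case (Suc n)
  note [measurable] = measurable_g_section[OF Suc.prems(1)[of 0]]
    measurable_path_integral[OF f Suc.prems(1)]
  have [measurable_cong]: "sets \<nu> = sets X" by fact
  have sp: "space \<nu> = space X" using Suc.prems(2) by (rule sets_eq_imp_space_eq)
  have "path_integral Q g n (\<lambda>i. y (Suc i)) (\<lambda>x. \<Sum>k. f k x) (Q x) =
        (\<Sum>k. path_integral Q g n (\<lambda>i. y (Suc i)) (f k) (Q x))" if "x \<in> space \<nu>" for x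
    by (rule Suc.IH) (use Suc.prems that sp measurable_space[OF Q] in \<open>auto simp: space_prob_algebra\<close>)
  then have "path_integral Q g (Suc n) y (\<lambda>x. \<Sum>k. f k x) \<nu> =
      (\<integral>\<^sup>+ x. ennreal (g x (y 0)) * (\<Sum>k. path_integral Q g n (\<lambda>i. y (Suc i)) (f k) (Q x)) \<partial>\<nu>)"
    by (auto intro!: nn_integral_cong)
  also have "\<dots> = (\<Sum>k. path_integral Q g (Suc n) y (f k) \<nu>)"
    by (subst path_integral.simps, subst nn_integral_suminf[symmetric]) (auto simp: ennreal_suminf_cmult)
  finally show ?case .
qed

lemma emeasure_filtering_dist:
  assumes y: "\<And>i. y i \<in> space Y" and \<nu>: "sets \<nu> = sets X" and A: "A \<in> sets X"
  shows "emeasure (filtering_dist Q g \<nu> n y) A =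
         path_integral Q g n y (indicator A) \<nu> / path_integral Q g n y (\<lambda>_. 1) \<nu>"
proof -
  let ?\<mu> = "\<lambda>A. path_integral Q g n y (indicator A) \<nu> / path_integral Q g n y (\<lambda>_. 1) \<nu>"
  have "path_integral Q g n y (\<lambda>x. 0) \<nu> = 0" for y and n and \<nu> :: "'x measure"
    by (induction n arbitrary: y \<nu>) auto
  then have "positive (sets \<nu>) ?\<mu>"
    by (simp add: positive_def indicator_def[abs_def])
  moreover have "countably_additive (sets \<nu>) ?\<mu>"
  proof (rule countably_additiveI)
    fix B :: "nat \<Rightarrow> 'x set"
    assume B: "range B \<subseteq> sets \<nu>" "disjoint_family B" "\<Union> (range B) \<in> sets \<nu>"
    have "(\<lambda>x. \<Sum>k. indicator (B k) x :: ennreal) = indicator (\<Union> (range B))"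
      by (intro ext suminf_indicator B(2))
    then have "path_integral Q g n y (indicator (\<Union> (range B))) \<nu> =
        (\<Sum>k. path_integral Q g n y (indicator (B k)) \<nu>)"
      using path_integral_suminf[of "\<lambda>k. indicator (B k)", OF _ y \<nu>] B(1) \<nu>
      by (auto simp: image_subset_iff)
    then show "(\<Sum>k. ?\<mu> (B k)) = ?\<mu> (\<Union> (range B))"
      by (simp add: divide_ennreal_def)
  qed
  ultimately show ?thesis
    unfolding filtering_dist_def
    using A by (intro emeasure_measure_of_sigma) (auto intro: sets.sigma_algebra_axioms simp flip: \<nu>)
qed

end

end

(* Write a(x), b(x) for the weights of the paths started at x, with and without the indicator of the
   event tested at time n.  The function a(z) b(z') - b(z) a(z') is antisymmetric, so it is annihilated
   by every symmetric product measure; on an LD-set C this allows one to remove the common minorant of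
   Q(x,.) and Q(x',.) at each transition of the pair from C x C to itself, gaining a factor rho < 1.
   By the drift condition each visit of the pair outside C x C at a time with Y in K gains a factor eta.
   If Y is in K more than half of the time, one of the two gains occurs at least of order gamma n times,
   and eta can be chosen so small that it beats the exponential bounds for the normalising constants:
   the upper one comes from Upsilon, the lower one from the paths that stay in D, governed by Psi. *)
theory Submission
  imports Defs
begin

section \<open>Coupling of two measures with a common minorant\<close>

text \<open>The two gains are not of the same kind. The factor \<rho> multiplies the true weights
  b(x) b(x'), so after integration it multiplies the product of the normalising constants and
  survives the division exactly. Only the \<eta> term, which multiplies products of Upsilon and V,
  has to beat exponentials. This avoids a circularity: \<eta> is fixed from \<gamma>, M and the
  lower constant of D alone, C is then chosen for this \<eta>, and \<rho>, which depends on C, may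
  be arbitrarily close to 1. The obstacle is that Q(x,.) x Q(x',.) without the common minorant is in
  general no product measure, and that the number of gains depends on the path of the pair. So no
  coupled process is built. The induction proves a pointwise inequality a(x) b(x') \<le> b(x) a(x')
  + error, where the error is a sum of two terms, each a function of x times a function of x', with
  exponents k and m that are free subject to a linear budget. Such an error integrates in closed
  form against every product measure.\<close>

lemma ennreal_prod_less_top:
  fixes f :: "'a \<Rightarrow> ennreal"
  assumes "\<And>i. i \<in> I \<Longrightarrow> f i < top"
  shows "(\<Prod>i\<in>I. f i) < top"
  using assms by (induction I rule: infinite_finite_induct) (auto simp: ennreal_mult_less_top)

text \<open>The local Doeblin condition speaks of sets, the induction needs it for functions: the
  two scaled restrictions to \<open>C\<close> are compared as measures, and integrals are monotone
  in the measure. Scalars on both sides let one statement serve the lower bound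
  (\<open>s = 1\<close>) and the upper bound (\<open>r = 1\<close>).\<close>

lemma nn_integral_restrict_mono_measure:
  fixes r s :: ennreal
  assumes sets: "sets M = sets N" and C: "C \<in> sets M"
    and le: "\<And>A. A \<in> sets M \<Longrightarrow> r * emeasure M (A \<inter> C) \<le> s * emeasure N (A \<inter> C)"
    and f: "f \<in> borel_measurable M"
  shows "r * (\<integral>\<^sup>+x\<in>C. f x \<partial>M) \<le> s * (\<integral>\<^sup>+x\<in>C. f x \<partial>N)"
proof -
  let ?M = "scale_measure r (density M (indicator C))" and ?N = "scale_measure s (density N (indicator C))"
  have CN: "C \<in> sets N" and fN: "f \<in> borel_measurable N"
    using C f sets by (auto cong: measurable_cong_sets)
  have "emeasure ?M A \<le> emeasure ?N A" for A
  proof (cases "A \<in> sets M")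
    case True
    then show ?thesis
      using C CN sets le[OF True] by (simp add: emeasure_density Int_commute flip: indicator_inter_arith)
  next
    case False
    then show ?thesis by (simp add: emeasure_notin_sets)
  qed
  then have "?M \<le> ?N"
    using sets sets_eq_imp_space_eq[OF sets] by (simp add: le_measure_iff le_fun_def space_scale_measure)
  then have "(\<integral>\<^sup>+x. f x \<partial>?M) \<le> (\<integral>\<^sup>+x. f x \<partial>?N)"
    using sets by (intro nn_integral_mono_measure) auto
  then show ?thesis
    using C CN f fN by (simp add: nn_integral_scale_measure nn_integral_density mult.commute)
qed

lemma nn_integral_pair_mult:
  assumes "sigma_finite_measure N" "f \<in> borel_measurable M" "h \<in> borel_measurable N"
  shows "(\<integral>\<^sup>+z. f (fst z) * h (snd z) \<partial>(M \<Otimes>\<^sub>M N)) = (\<integral>\<^sup>+x. f x \<partial>M) * (\<integral>\<^sup>+x. h x \<partial>N)"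
proof -
  interpret sigma_finite_measure N by fact
  note [measurable] = assms(2,3)
  show ?thesis
    by (subst nn_integral_fst[symmetric]) (auto simp: nn_integral_cmult nn_integral_multc)
qed

text \<open>Let u = B + w - A with A(z,z') = a(z) b(z') and B(z,z') = b(z) a(z'). A and B have the
  same finite integral under L x L, hence so do u and w, up to finiteness. As u \<ge> 0 and L x L is
  dominated by M x M', the integral of u under M x M' is at least that of w under L x L, hence at
  least \<kappa>^2 times that of w over C x C. Integrating A + u = B + w against M x M' gives the
  claim; the difference of the two product measures is never formed.\<close>

lemma coupling_step:
  fixes L M M' :: "'a measure" and \<kappa> :: real
  assumes sets[measurable_cong]: "sets M = sets L" "sets M' = sets L"
    and fin: "finite_measure L" "finite_measure M" "finite_measure M'"
    and C[measurable]: "C \<in> sets L" and \<kappa>: "0 \<le> \<kappa>" "\<kappa> \<le> 1"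
    and dom: "\<And>f. f \<in> borel_measurable L \<Longrightarrow> (\<integral>\<^sup>+z. f z \<partial>L) \<le> (\<integral>\<^sup>+z. f z \<partial>M)"
             "\<And>f. f \<in> borel_measurable L \<Longrightarrow> (\<integral>\<^sup>+z. f z \<partial>L) \<le> (\<integral>\<^sup>+z. f z \<partial>M')"
    and minor: "\<And>f. f \<in> borel_measurable L \<Longrightarrow> \<kappa> * (\<integral>\<^sup>+z\<in>C. f z \<partial>M) \<le> (\<integral>\<^sup>+z. f z \<partial>L)"
               "\<And>f. f \<in> borel_measurable L \<Longrightarrow> \<kappa> * (\<integral>\<^sup>+z\<in>C. f z \<partial>M') \<le> (\<integral>\<^sup>+z. f z \<partial>L)"
    and ab[measurable]: "a \<in> borel_measurable L" "b \<in> borel_measurable L"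
    and w[measurable]: "w \<in> borel_measurable (L \<Otimes>\<^sub>M L)"
    and le: "\<And>z z'. z \<in> space L \<Longrightarrow> z' \<in> space L \<Longrightarrow> a z * b z' \<le> b z * a z' + w (z, z')"
    and finab: "(\<integral>\<^sup>+z. a z \<partial>L) < \<infinity>" "(\<integral>\<^sup>+z. b z \<partial>L) < \<infinity>"
    and finw: "(\<integral>\<^sup>+z. w z \<partial>(M \<Otimes>\<^sub>M M')) < \<infinity>"
  shows "(\<integral>\<^sup>+z. a z \<partial>M) * (\<integral>\<^sup>+z. b z \<partial>M') \<le> (\<integral>\<^sup>+z. b z \<partial>M) * (\<integral>\<^sup>+z. a z \<partial>M') +
    (\<integral>\<^sup>+z. (if z \<in> C \<times> C then ennreal (1 - \<kappa>\<^sup>2) else 1) * w z \<partial>(M \<Otimes>\<^sub>M M'))" (is "_ \<le> _ + ?R")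
proof -
  interpret L: finite_measure L by fact
  interpret M: finite_measure M by fact
  interpret M': finite_measure M' by fact
  have sp: "space M = space L" "space M' = space L"
    using sets_eq_imp_space_eq[OF sets(1)] sets_eq_imp_space_eq[OF sets(2)] .
  let ?P = "M \<Otimes>\<^sub>M M'" and ?PL = "L \<Otimes>\<^sub>M L"
  define A where "A z = a (fst z) * b (snd z)" for z
  define B where "B z = b (fst z) * a (snd z)" for z
  \<comment> \<open>Subtraction in \<open>ennreal\<close> truncates at 0; by \<open>le\<close> no
    truncation happens on the space, which is the identity \<open>split\<close>.\<close>
  define u where "u z = B z + w z - A z" for z
  have [measurable]: "A \<in> borel_measurable (L \<Otimes>\<^sub>M L)" "B \<in> borel_measurable (L \<Otimes>\<^sub>M L)"
    unfolding A_def[abs_def] B_def[abs_def] by measurable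
  then have [measurable]: "u \<in> borel_measurable (L \<Otimes>\<^sub>M L)"
    unfolding u_def[abs_def] by measurable
  have split: "B z + w z = A z + u z" if "z \<in> space (L \<Otimes>\<^sub>M L)" for z
  proof -
    have "A z \<le> B z + w z"
      using le[of "fst z" "snd z"] that by (auto simp: space_pair_measure A_def B_def)
    then show ?thesis
      unfolding u_def by (simp only: add_diff_inverse_ennreal)
  qed
  have AB_L: "(\<integral>\<^sup>+z. A z \<partial>?PL) = (\<integral>\<^sup>+z. B z \<partial>?PL)" "(\<integral>\<^sup>+z. A z \<partial>?PL) < \<infinity>"
    using finab mult.commute[of "\<integral>\<^sup>+z. a z \<partial>L" "\<integral>\<^sup>+z. b z \<partial>L"] unfolding A_def B_def
    by (auto simp: nn_integral_pair_mult L.sigma_finite_measure_axioms ennreal_mult_less_top)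
  have A_P: "(\<integral>\<^sup>+z. A z \<partial>?P) = (\<integral>\<^sup>+z. a z \<partial>M) * (\<integral>\<^sup>+z. b z \<partial>M')"
   and B_P: "(\<integral>\<^sup>+z. B z \<partial>?P) = (\<integral>\<^sup>+z. b z \<partial>M) * (\<integral>\<^sup>+z. a z \<partial>M')"
    unfolding A_def B_def by (simp_all add: nn_integral_pair_mult M'.sigma_finite_measure_axioms)
  have u_le: "(\<integral>\<^sup>+z. u z \<partial>?PL) \<le> (\<integral>\<^sup>+z. u z \<partial>?P)"
  proof -
    have "(\<integral>\<^sup>+z. u z \<partial>?PL) = (\<integral>\<^sup>+x. \<integral>\<^sup>+y. u (x, y) \<partial>L \<partial>L)"
      by (simp add: L.nn_integral_fst)
    also have "\<dots> \<le> (\<integral>\<^sup>+x. \<integral>\<^sup>+y. u (x, y) \<partial>M' \<partial>L)"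
      by (intro nn_integral_mono dom) measurable
    also have "\<dots> \<le> (\<integral>\<^sup>+x. \<integral>\<^sup>+y. u (x, y) \<partial>M' \<partial>M)"
      by (intro dom) measurable
    also have "\<dots> = (\<integral>\<^sup>+z. u z \<partial>?P)"
      by (simp add: M'.nn_integral_fst)
    finally show ?thesis .
  qed
  have sum_L: "(\<integral>\<^sup>+z. B z \<partial>?PL) + (\<integral>\<^sup>+z. w z \<partial>?PL) = (\<integral>\<^sup>+z. A z \<partial>?PL) + (\<integral>\<^sup>+z. u z \<partial>?PL)"
    by (subst (1 2) nn_integral_add[symmetric], measurable) (intro nn_integral_cong split)
  have sum_P: "(\<integral>\<^sup>+z. B z \<partial>?P) + (\<integral>\<^sup>+z. w z \<partial>?P) = (\<integral>\<^sup>+z. A z \<partial>?P) + (\<integral>\<^sup>+z. u z \<partial>?P)"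
    by (subst (1 2) nn_integral_add[symmetric], measurable)
       (intro nn_integral_cong split, simp add: space_pair_measure sp)
  have wu: "(\<integral>\<^sup>+z. w z \<partial>?PL) = (\<integral>\<^sup>+z. u z \<partial>?PL)"
    using sum_L AB_L by (auto simp: ennreal_add_left_cancel)
  have w_minor: "\<kappa> * (\<kappa> * (\<integral>\<^sup>+z\<in>C \<times> C. w z \<partial>?P)) \<le> (\<integral>\<^sup>+z. w z \<partial>?PL)"
  proof -
    have "(\<integral>\<^sup>+z\<in>C \<times> C. w z \<partial>?P) = (\<integral>\<^sup>+x. \<integral>\<^sup>+y. w (x, y) * indicator (C \<times> C) (x, y) \<partial>M' \<partial>M)"
      by (subst M'.nn_integral_fst) auto
    also have "\<dots> = (\<integral>\<^sup>+x\<in>C. \<integral>\<^sup>+y\<in>C. w (x, y) \<partial>M' \<partial>M)"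
      by (intro nn_integral_cong) (simp add: indicator_def)
    finally have "\<kappa> * (\<kappa> * (\<integral>\<^sup>+z\<in>C \<times> C. w z \<partial>?P)) =
        \<kappa> * (\<kappa> * (\<integral>\<^sup>+x\<in>C. \<integral>\<^sup>+y\<in>C. w (x, y) \<partial>M' \<partial>M))"
      by simp
    also have "\<dots> = \<kappa> * (\<integral>\<^sup>+x\<in>C. \<kappa> * (\<integral>\<^sup>+y\<in>C. w (x, y) \<partial>M') \<partial>M)"
      by (simp add: mult.assoc nn_integral_cmult)
    also have "\<dots> \<le> \<kappa> * (\<integral>\<^sup>+x\<in>C. \<integral>\<^sup>+y. w (x, y) \<partial>L \<partial>M)"
      by (intro mult_left_mono nn_integral_mono mult_right_mono minor) (auto simp: sp)
    also have "\<dots> \<le> (\<integral>\<^sup>+x. \<integral>\<^sup>+y. w (x, y) \<partial>L \<partial>L)"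
      by (intro minor) measurable
    also have "\<dots> = (\<integral>\<^sup>+z. w z \<partial>?PL)"
      by (simp add: L.nn_integral_fst)
    finally show ?thesis .
  qed
  have w_split: "(\<integral>\<^sup>+z. w z \<partial>?P) = \<kappa> * (\<kappa> * (\<integral>\<^sup>+z\<in>C \<times> C. w z \<partial>?P)) + ?R"
  proof -
    have "\<kappa>\<^sup>2 \<le> 1" using \<kappa> by (simp add: power_le_one)
    then have "ennreal (\<kappa>\<^sup>2) + ennreal (1 - \<kappa>\<^sup>2) = 1"
      by (simp flip: ennreal_plus)
    then have "w z = ennreal (\<kappa>\<^sup>2) * (w z * indicator (C \<times> C) z) +
        (if z \<in> C \<times> C then ennreal (1 - \<kappa>\<^sup>2) else 1) * w z" for z
      by (auto simp: indicator_def simp flip: distrib_right)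
    then have "(\<integral>\<^sup>+z. w z \<partial>?P) = (\<integral>\<^sup>+z. ennreal (\<kappa>\<^sup>2) * (w z * indicator (C \<times> C) z) +
        (if z \<in> C \<times> C then ennreal (1 - \<kappa>\<^sup>2) else 1) * w z \<partial>?P)"
      by (rule nn_integral_cong)
    also have "\<dots> = ennreal (\<kappa>\<^sup>2) * (\<integral>\<^sup>+z\<in>C \<times> C. w z \<partial>?P) + ?R"
      by (subst nn_integral_add) (auto simp: nn_integral_cmult)
    finally show ?thesis
      using \<kappa> by (simp add: power2_eq_square ennreal_mult mult.assoc)
  qed
  \<comment> \<open>The part of the integral of \<open>w\<close> that is cancelled on both sides,
    which is allowed because \<open>finw\<close> makes it finite.\<close>
  define k where "k = \<kappa> * (\<kappa> * (\<integral>\<^sup>+z\<in>C \<times> C. w z \<partial>?P))"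
  have "k + (\<integral>\<^sup>+z. A z \<partial>?P) \<le> (\<integral>\<^sup>+z. A z \<partial>?P) + (\<integral>\<^sup>+z. u z \<partial>?P)"
    using w_minor u_le wu unfolding k_def by (subst add.commute, intro add_left_mono) simp
  also have "\<dots> = k + ((\<integral>\<^sup>+z. B z \<partial>?P) + ?R)"
    unfolding sum_P[symmetric] w_split k_def[symmetric] by (simp add: ac_simps)
  finally have "k = \<infinity> \<or> (\<integral>\<^sup>+z. A z \<partial>?P) \<le> (\<integral>\<^sup>+z. B z \<partial>?P) + ?R"
    unfolding ennreal_add_left_cancel_le .
  moreover have "k < \<infinity>"
    using finw w_split unfolding k_def[symmetric] by auto
  ultimately show ?thesis
    unfolding A_P B_P by auto
qed

section \<open>Extended logarithms and exponential rates\<close>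

text \<open>\<open>p\<close> and \<open>p'\<close> stand for unnormalised masses of an event,
  \<open>N\<close> and \<open>N'\<close> for normalising constants. The term
  \<open>r * (N * N')\<close> turns into exactly \<open>r\<close>, while \<open>E\<close> remains to
  be weighed against a lower bound for \<open>N * N'\<close>.\<close>

lemma ennreal_quotient_le:
  fixes p p' N N' r E :: ennreal
  assumes le: "p * N' \<le> N * p' + (r * (N * N') + E)"
    and N: "0 < N" "N < top" "0 < N'" "N' < top"
  shows "p / N \<le> p' / N' + (r + E / (N * N'))"
proof -
  have NN: "0 < N * N'" "N * N' < top"
    using N by (auto simp: ennreal_mult_less_top ennreal_zero_less_mult_iff)
  have "p / N = (p * N') / (N * N')"
    using N by (simp add: divide_mult_eq)
  also have "\<dots> \<le> (p' * N + (r * (N * N') + E)) / (N * N')"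
    using le by (intro divide_right_mono_ennreal) (simp add: mult.commute)
  also have "\<dots> = p' * N / (N' * N) + (r * (N * N') / (N * N') + E / (N * N'))"
    by (simp add: add_divide_distrib_ennreal mult.commute)
  also have "p' * N / (N' * N) = p' / N'"
    using N by (intro divide_mult_eq) auto
  also have "r * (N * N') / (N * N') = r"
    using NN by (intro mult_divide_eq_ennreal) auto
  finally show ?thesis .
qed

lemma ennreal_inverse_antimono:
  fixes a b :: ennreal
  shows "a \<le> b \<Longrightarrow> inverse b \<le> inverse a"
  including ennreal.lifting by transfer (rule ereal_inverse_antimono)

lemma elog_ennreal: "0 < r \<Longrightarrow> elog (ennreal r) = ereal (ln r)"
  by (simp add: elog_def ennreal_eq_0_iff)

lemma elog_prod:
  assumes "finite I" "\<And>i. i \<in> I \<Longrightarrow> 0 < f i \<and> f i < top"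
  shows "(\<Sum>i\<in>I. elog (f i)) = elog (\<Prod>i\<in>I. f i)" "0 < (\<Prod>i\<in>I. f i)" "(\<Prod>i\<in>I. f i) < top"
proof -
  have "(\<Sum>i\<in>I. elog (f i)) = elog (\<Prod>i\<in>I. f i) \<and> 0 < (\<Prod>i\<in>I. f i) \<and> (\<Prod>i\<in>I. f i) < top"
    using assms
  proof (induction I)
    case empty
    show ?case by (simp add: elog_def)
  next
    case (insert i I)
    then have "0 < f i \<and> f i < top" by simp
    then obtain r where r: "f i = ennreal r" "0 < r"
      by (cases "f i") auto
    obtain s where s: "(\<Prod>i\<in>I. f i) = ennreal s" "0 < s"
      using insert by (cases "\<Prod>i\<in>I. f i") auto
    show ?case
      using insert r s by (simp add: elog_ennreal ln_mult flip: ennreal_mult)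
  qed
  then show "(\<Sum>i\<in>I. elog (f i)) = elog (\<Prod>i\<in>I. f i)" "0 < (\<Prod>i\<in>I. f i)" "(\<Prod>i\<in>I. f i) < top"
    by auto
qed

lemma elog_divide_less_imp:
  assumes "elog z / ereal (real n) < ereal M" "0 < z" "z < top" "n > 0"
  shows "z \<le> ennreal (exp (M * real n))"
proof -
  obtain r where r: "z = ennreal r" "0 < r" using assms by (cases z) auto
  then have "ln r < M * real n"
    using assms by (simp add: elog_ennreal divide_less_eq)
  then have "r < exp (M * real n)"
    using r(2) by (metis exp_less_mono exp_ln)
  then show ?thesis using r by (simp add: ennreal_leI)
qed

lemma elog_divide_greater_imp:
  assumes "elog z / ereal (real n) > ereal M" "0 < z" "z < top" "n > 0"
  shows "ennreal (exp (M * real n)) \<le> z"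
proof -
  obtain r where r: "z = ennreal r" "0 < r" using assms by (cases z) auto
  then have "M * real n < ln r"
    using assms by (simp add: elog_ennreal less_divide_eq)
  then have "exp (M * real n) < r"
    using r(2) by (metis exp_less_mono exp_ln)
  then show ?thesis using r by (simp add: ennreal_leI)
qed

lemma limsup_elog_le:
  fixes T :: "nat \<Rightarrow> ennreal"
  assumes C: "C > 0" and T: "\<forall>\<^sub>F n in sequentially. T n \<le> ennreal (C * exp (- d * real n))"
  shows "limsup (\<lambda>n. elog (T n) / ereal (real n)) \<le> ereal (- d)"
proof -
  have "\<forall>\<^sub>F n in sequentially. elog (T n) / ereal (real n) \<le> ereal (ln C / real n - d)"
    using T eventually_gt_at_top[of 0]
  proof eventually_elim
    case (elim n)
    show ?case
    proof (cases "T n = 0")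
      \<comment> \<open>This happens when the two filtering distributions coincide; the logarithm is
        then \<open>-\<infinity>\<close> and lies below every bound.\<close>
      case True
      then show ?thesis using elim by (simp add: elog_def)
    next
      case False
      then obtain r where r: "T n = ennreal r" "0 < r"
        using elim by (cases "T n") (auto simp: top_unique)
      then have "r \<le> C * exp (- d * real n)"
        using elim C by (simp add: ennreal_le_iff)
      then have "ln r \<le> ln C + - d * real n"
        using r(2) C by (metis ln_mult ln_exp ln_mono exp_gt_zero mult_pos_pos not_less less_numeral_extra(3))
      then have "ln r / real n \<le> ln C / real n - d"
        using elim by (simp add: field_simps)
      then show ?thesis using r elim by (simp add: elog_ennreal)
    qed
  qed
  then have "limsup (\<lambda>n. elog (T n) / ereal (real n)) \<le> limsup (\<lambda>n. ereal (ln C / real n - d))"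
    by (rule Limsup_mono)
  also have "(\<lambda>n. ereal (ln C / real n - d)) \<longlonglongrightarrow> ereal (0 - d)"
    by (intro tendsto_intros lim_const_over_n)
  then have "limsup (\<lambda>n. ereal (ln C / real n - d)) = ereal (- d)"
    using lim_imp_Limsup[OF sequentially_bot] by auto
  finally show ?thesis .
qed

section \<open>Path weights under a drift condition\<close>

locale drift_model =
  fixes X :: "'x measure" and Y :: "'y measure"
    and Q :: "'x \<Rightarrow> 'x measure" and g :: "'x \<Rightarrow> 'y \<Rightarrow> real" and V :: "'x \<Rightarrow> real"
  assumes Q: "Q \<in> measurable X (prob_algebra X)"
    and g: "case_prod g \<in> borel_measurable (X \<Otimes>\<^sub>M Y)"
    and g_pos: "\<And>x y. x \<in> space X \<Longrightarrow> y \<in> space Y \<Longrightarrow> g x y > 0"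
    and V[measurable]: "V \<in> borel_measurable X"
    and V_ge_1: "\<And>x. x \<in> space X \<Longrightarrow> V x \<ge> 1"
begin

abbreviation QV :: "'x \<Rightarrow> ennreal" where
  "QV x \<equiv> \<integral>\<^sup>+z. ennreal (V z) \<partial>Q x"

abbreviation Ups :: "'y \<Rightarrow> ennreal" where
  "Ups \<equiv> Upsilon Q g V (space X)"

text \<open>The integrand of \<open>path_integral\<close> as a function of the initial state, that
  is, the path integral started from a point mass. It makes pointwise comparison of two starting
  points possible without Dirac measures.\<close>

definition weight :: "nat \<Rightarrow> (nat \<Rightarrow> 'y) \<Rightarrow> ('x \<Rightarrow> ennreal) \<Rightarrow> 'x \<Rightarrow> ennreal" where
  "weight n y f x = ennreal (g x (y 0)) *
     (case n of 0 \<Rightarrow> f x | Suc m \<Rightarrow> path_integral Q g m (\<lambda>i. y (Suc i)) f (Q x))"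

lemma path_integral_eq_weight: "path_integral Q g n y f \<nu> = (\<integral>\<^sup>+x. weight n y f x \<partial>\<nu>)"
  by (cases n) (simp_all add: weight_def)

lemma weight_0: "weight 0 y f x = ennreal (g x (y 0)) * f x"
  by (simp add: weight_def)

lemma weight_Suc:
  "weight (Suc n) y f x = ennreal (g x (y 0)) * (\<integral>\<^sup>+z. weight n (\<lambda>i. y (Suc i)) f z \<partial>Q x)"
  by (simp add: weight_def path_integral_eq_weight)

lemma kernel:
  assumes "x \<in> space X"
  shows "sets (Q x) = sets X" "space (Q x) = space X" "prob_space (Q x)"
  using measurable_space[OF Q assms] sets_eq_imp_space_eq[of "Q x" X] by (auto simp: space_prob_algebra)

lemma measurable_weight:
  assumes f[measurable]: "f \<in> borel_measurable X" and y: "\<And>i. y i \<in> space Y"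
  shows "weight n y f \<in> borel_measurable X"
proof -
  note [measurable] = measurable_g_section[OF Q g y[of 0]]
    measurable_path_integral[OF Q g f, of "\<lambda>i. y (Suc i)"]
  show ?thesis
    using y unfolding weight_def by (cases n) simp_all
qed

lemma weight_mono:
  assumes "\<And>z. z \<in> space X \<Longrightarrow> f z \<le> h z" "x \<in> space X"
  shows "weight n y f x \<le> weight n y h x"
  using assms(2)
proof (induction n arbitrary: x y)
  case 0
  then show ?case using assms(1) by (simp add: weight_0 mult_left_mono)
next
  case (Suc n)
  then show ?case
    unfolding weight_Suc by (intro mult_left_mono nn_integral_mono) (auto simp: kernel)
qed

lemma drift:
  assumes "x \<in> A" "x \<in> space X"
  shows "ennreal (g x y) * QV x \<le> Upsilon Q g V A y * ennreal (V x)"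
proof -
  have V: "0 < ennreal (V x)" "ennreal (V x) < top"
    using V_ge_1[OF assms(2)] by auto
  have "ennreal (g x y) * QV x = ennreal (g x y) * QV x / ennreal (V x) * ennreal (V x)"
    using V by (simp add: ennreal_divide_times)
  also have "\<dots> \<le> Upsilon Q g V A y * ennreal (V x)"
    unfolding Upsilon_def using assms(1) by (intro mult_right_mono SUP_upper) auto
  finally show ?thesis .
qed

lemma QV_ge_1:
  assumes "x \<in> space X"
  shows "1 \<le> QV x"
proof -
  interpret prob_space "Q x" using kernel[OF assms] by simp
  have "1 = (\<integral>\<^sup>+z. 1 \<partial>Q x)" by (simp add: emeasure_space_1)
  also have "\<dots> \<le> QV x"
    using V_ge_1 kernel[OF assms] by (intro nn_integral_mono) auto
  finally show ?thesis .
qed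

text \<open>A single observation with finite \<open>Ups y\<close> bounds
  \<open>g x y * QV x\<close>, and \<open>g x y > 0\<close> then passes the finiteness on to
  \<open>QV x\<close>.\<close>

lemma QV_finite:
  assumes "x \<in> space X" "y \<in> space Y" "Ups y < \<infinity>"
  shows "QV x < \<infinity>"
proof -
  have "ennreal (g x y) * QV x < \<infinity>"
    using drift[of x "space X" y] assms
    by (intro le_less_trans[OF drift[of x "space X"]]) (auto simp: ennreal_mult_less_top)
  then show ?thesis
    using g_pos[OF assms(1,2)] QV_ge_1[OF assms(1)] by (auto simp: ennreal_mult_less_top)
qed

lemma weight_le:
  assumes "x \<in> space X"
  shows "weight n y (\<lambda>_. 1) x \<le> (\<Prod>i\<le>n. Ups (y i)) * ennreal (V x)"
  using assms
proof (induction n arbitrary: x y)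
  case 0
  \<comment> \<open>No transition follows the last observation; inserting
    \<open>QV x \<ge> 1\<close> lets this observation be bounded by the drift as well.\<close>
  have "ennreal (g x (y 0)) * 1 \<le> ennreal (g x (y 0)) * QV x"
    using QV_ge_1[OF 0] by (intro mult_left_mono) auto
  also have "\<dots> \<le> Ups (y 0) * ennreal (V x)"
    using 0 by (intro drift)
  finally show ?case by (simp add: weight_0)
next
  case (Suc n)
  let ?P = "\<Prod>i\<le>n. Ups (y (Suc i))"
  have [measurable]: "V \<in> borel_measurable (Q x)"
    using V kernel[OF Suc.prems] by (simp cong: measurable_cong_sets)
  have "weight (Suc n) y (\<lambda>_. 1) x \<le> ennreal (g x (y 0)) * (\<integral>\<^sup>+z. ?P * ennreal (V z) \<partial>Q x)"
    unfolding weight_Suc using kernel[OF Suc.prems]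
    by (intro mult_left_mono nn_integral_mono Suc.IH) auto
  also have "\<dots> = ?P * (ennreal (g x (y 0)) * QV x)"
    by (subst nn_integral_cmult) (simp_all add: ac_simps)
  also have "\<dots> \<le> ?P * (Ups (y 0) * ennreal (V x))"
    using Suc.prems by (intro mult_left_mono drift) auto
  also have "\<dots> = (\<Prod>i\<le>Suc n. Ups (y i)) * ennreal (V x)"
    by (simp add: prod.atMost_Suc_shift ac_simps del: prod.atMost_Suc)
  finally show ?case .
qed

section \<open>Consequences of the local Doeblin condition\<close>

text \<open>For x in C, \<open>Q x\<close> is a probability measure, so \<open>em\<close> times the
  mass of \<open>C\<close> under \<open>\<Lambda>\<close> is at most 1. With this mass positive and
  finite it can be cancelled from the two-sided bound, leaving \<open>em \<le> ep\<close>.\<close>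

lemma LD_mass:
  assumes "LD_set_with X Q C \<Lambda> em ep"
  shows "C \<noteq> {}" "emeasure \<Lambda> C < \<infinity>" "em \<le> ep"
proof -
  have LD: "C \<in> sets X" "0 < em" "0 < ep" "0 < emeasure \<Lambda> C"
    and le: "\<And>x. x \<in> C \<Longrightarrow> ennreal em * emeasure \<Lambda> C \<le> emeasure (Q x) C"
      "\<And>x. x \<in> C \<Longrightarrow> emeasure (Q x) C \<le> ennreal ep * emeasure \<Lambda> C"
    using assms unfolding LD_set_with_def by (blast, blast, blast, blast, (metis inf.idem)+)
  show "C \<noteq> {}" using LD by auto
  then obtain x where x: "x \<in> C" by auto
  then have "x \<in> space X" using LD sets.sets_into_space by auto
  then interpret prob_space "Q x" using kernel by simp
  have "ennreal em * emeasure \<Lambda> C \<le> 1"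
    using le(1)[OF x] measure_le_1 by (rule order_trans)
  then show fin: "emeasure \<Lambda> C < \<infinity>"
    using LD by (auto simp: less_top[symmetric] ennreal_mult_top top_unique)
  show "em \<le> ep"
  proof -
    have "ennreal em * emeasure \<Lambda> C \<le> ennreal ep * emeasure \<Lambda> C"
      using le(1)[OF x] le(2)[OF x] by (rule order_trans)
    then have "ennreal (em * measure \<Lambda> C) \<le> ennreal (ep * measure \<Lambda> C)"
      using fin LD by (simp add: emeasure_eq_ennreal_measure less_top ennreal_mult)
    moreover have "0 < measure \<Lambda> C"
      using fin LD by (simp add: measure_def enn2real_positive_iff less_top)
    ultimately show ?thesis
      using LD by (simp add: ennreal_le_iff)
  qed
qed

lemma LD_nn_integral:
  assumes LD: "LD_set_with X Q C \<Lambda> em ep" and x: "x \<in> C" and f: "f \<in> borel_measurable X"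
  shows "ennreal em * (\<integral>\<^sup>+z\<in>C. f z \<partial>\<Lambda>) \<le> (\<integral>\<^sup>+z\<in>C. f z \<partial>Q x)"
    and "(\<integral>\<^sup>+z\<in>C. f z \<partial>Q x) \<le> ennreal ep * (\<integral>\<^sup>+z\<in>C. f z \<partial>\<Lambda>)"
proof -
  have C: "C \<in> sets X" "sets \<Lambda> = sets X"
    using LD unfolding LD_set_with_def by auto
  then have "x \<in> space X" using x sets.sets_into_space by auto
  note k = kernel(1)[OF this]
  have "f \<in> borel_measurable \<Lambda>" "f \<in> borel_measurable (Q x)"
    using f C k by (auto cong: measurable_cong_sets)
  then show "ennreal em * (\<integral>\<^sup>+z\<in>C. f z \<partial>\<Lambda>) \<le> (\<integral>\<^sup>+z\<in>C. f z \<partial>Q x)"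
     "(\<integral>\<^sup>+z\<in>C. f z \<partial>Q x) \<le> ennreal ep * (\<integral>\<^sup>+z\<in>C. f z \<partial>\<Lambda>)"
    using LD x C k nn_integral_restrict_mono_measure[of \<Lambda> "Q x" C "ennreal em" 1 f]
      nn_integral_restrict_mono_measure[of "Q x" \<Lambda> C 1 "ennreal ep" f]
    unfolding LD_set_with_def by auto
qed

text \<open>The minorant is \<open>em\<close> times the restriction of \<open>\<Lambda>\<close> to
  \<open>C\<close>. The upper half of the condition shows that \<open>em / ep\<close> times the
  restriction of \<open>Q x\<close> to \<open>C\<close> lies below it; one such factor for each
  coordinate gives the square.\<close>

lemma LD_coupling_step:
  assumes LD: "LD_set_with X Q C \<Lambda> em ep" and x: "x \<in> C" "x' \<in> C"
    and ab: "a \<in> borel_measurable X" "b \<in> borel_measurable X"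
    and w: "w \<in> borel_measurable (X \<Otimes>\<^sub>M X)"
    and le: "\<And>z z'. z \<in> space X \<Longrightarrow> z' \<in> space X \<Longrightarrow> a z * b z' \<le> b z * a z' + w (z, z')"
    and fin: "(\<integral>\<^sup>+z. a z \<partial>Q x) < \<infinity>" "(\<integral>\<^sup>+z. b z \<partial>Q x) < \<infinity>"
      "(\<integral>\<^sup>+z. w z \<partial>(Q x \<Otimes>\<^sub>M Q x')) < \<infinity>"
  shows "(\<integral>\<^sup>+z. a z \<partial>Q x) * (\<integral>\<^sup>+z. b z \<partial>Q x') \<le> (\<integral>\<^sup>+z. b z \<partial>Q x) * (\<integral>\<^sup>+z. a z \<partial>Q x') +
    (\<integral>\<^sup>+z. (if z \<in> C \<times> C then ennreal (1 - (em / ep)\<^sup>2) else 1) * w z \<partial>(Q x \<Otimes>\<^sub>M Q x'))"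
proof -
  define L where "L = scale_measure (ennreal em) (density \<Lambda> (indicator C))"
  have C[measurable]: "C \<in> sets X" and \<Lambda>[measurable_cong]: "sets \<Lambda> = sets X" and e: "0 < em" "0 < ep"
    using LD unfolding LD_set_with_def by auto
  have xX: "x \<in> space X" "x' \<in> space X"
    using x sets.sets_into_space[OF C] by auto
  interpret Q: prob_space "Q x" using kernel[OF xX(1)] by simp
  interpret Q': prob_space "Q x'" using kernel[OF xX(2)] by simp
  have L[measurable_cong]: "sets L = sets X" and spL: "space L = space X"
    using \<Lambda> sets_eq_imp_space_eq[OF \<Lambda>] by (simp_all add: L_def space_scale_measure)
  have int_L: "(\<integral>\<^sup>+z. f z \<partial>L) = ennreal em * (\<integral>\<^sup>+z\<in>C. f z \<partial>\<Lambda>)" if "f \<in> borel_measurable X" for f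
  proof -
    have [measurable]: "f \<in> borel_measurable \<Lambda>"
      using that \<Lambda> by (simp cong: measurable_cong_sets)
    show ?thesis
      unfolding L_def by (simp add: nn_integral_scale_measure nn_integral_density mult.commute)
  qed
  have dom: "(\<integral>\<^sup>+z. f z \<partial>L) \<le> (\<integral>\<^sup>+z. f z \<partial>Q v)" if "f \<in> borel_measurable L" "v \<in> C" for f v
  proof -
    have f: "f \<in> borel_measurable X" using that by simp
    have "(\<integral>\<^sup>+z. f z \<partial>L) \<le> (\<integral>\<^sup>+z\<in>C. f z \<partial>Q v)"
      unfolding int_L[OF f] by (rule LD_nn_integral(1)[OF LD that(2) f])
    also have "\<dots> \<le> (\<integral>\<^sup>+z. f z \<partial>Q v)"
      by (intro nn_integral_mono) (simp add: indicator_def)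
    finally show ?thesis .
  qed
  have minor: "ennreal (em / ep) * (\<integral>\<^sup>+z\<in>C. f z \<partial>Q v) \<le> (\<integral>\<^sup>+z. f z \<partial>L)"
    if "f \<in> borel_measurable L" "v \<in> C" for f v
  proof -
    have f: "f \<in> borel_measurable X" using that by simp
    have "ennreal (em / ep) * (\<integral>\<^sup>+z\<in>C. f z \<partial>Q v) \<le> ennreal (em / ep) * (ennreal ep * (\<integral>\<^sup>+z\<in>C. f z \<partial>\<Lambda>))"
      by (intro mult_left_mono LD_nn_integral(2)[OF LD that(2) f]) simp
    also have "\<dots> = (\<integral>\<^sup>+z. f z \<partial>L)"
      unfolding int_L[OF f] using e by (simp add: mult.assoc[symmetric] ennreal_mult[symmetric])
    finally show ?thesis .
  qed
  have "emeasure L (space L) < \<infinity>"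
    using LD_mass(2)[OF LD] int_L[of "\<lambda>_. 1"] by (simp add: ennreal_mult_less_top)
  then have "finite_measure L" by (intro finite_measureI) simp
  moreover have "em / ep \<le> 1" "0 \<le> em / ep" using LD_mass(3)[OF LD] e by auto
  moreover have "a \<in> borel_measurable L" "b \<in> borel_measurable L" "w \<in> borel_measurable (L \<Otimes>\<^sub>M L)"
    using ab w by simp_all
  moreover have "(\<integral>\<^sup>+z. a z \<partial>L) < \<infinity>" "(\<integral>\<^sup>+z. b z \<partial>L) < \<infinity>"
    using dom[of a x] dom[of b x] fin ab x by (auto intro: le_less_trans)
  ultimately show ?thesis
    using kernel[OF xX(1)] kernel[OF xX(2)] dom minor x le fin C
    by (intro coupling_step[of "Q x" L "Q x'" C])
       (auto simp: spL L Q.finite_measure_axioms Q'.finite_measure_axioms)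
qed

section \<open>Forgetting for a pair of starting points\<close>

text \<open>Once an exponent is exhausted, its error term alone suffices: for \<open>k = 0\<close>
  it contains b(x) b(x'), which dominates the left side because f \<le> 1; for \<open>m = 0\<close>
  it is the bound of b(x) b(x') given by the drift.\<close>

lemma weight_forgetting_trivial:
  assumes f_le: "\<And>z. z \<in> space X \<Longrightarrow> f z \<le> 1"
    and x: "x \<in> space X" "x' \<in> space X" and km: "k = 0 \<or> m = 0"
  shows "weight n y f x * weight n y (\<lambda>_. 1) x' \<le> weight n y (\<lambda>_. 1) x * weight n y f x' +
    (\<rho> ^ k * (weight n y (\<lambda>_. 1) x * weight n y (\<lambda>_. 1) x') +
     \<eta> ^ m * ((\<Prod>i\<le>n. Ups (y i))\<^sup>2 * (ennreal (V x) * ennreal (V x'))))"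
proof -
  let ?b = "weight n y (\<lambda>_. 1)" and ?c = "\<Prod>i\<le>n. Ups (y i)"
  have le: "weight n y f x * ?b x' \<le> ?b x * ?b x'"
    using x f_le by (intro mult_right_mono weight_mono) auto
  also have "\<dots> \<le> \<rho> ^ k * (?b x * ?b x') + \<eta> ^ m * (?c\<^sup>2 * (ennreal (V x) * ennreal (V x')))"
  proof (cases "k = 0")
    case True
    then show ?thesis by simp
  next
    case False
    have "?b x * ?b x' \<le> (?c * ennreal (V x)) * (?c * ennreal (V x'))"
      using x by (intro mult_mono weight_le) auto
    also have "\<dots> = \<eta> ^ m * (?c\<^sup>2 * (ennreal (V x) * ennreal (V x')))"
      using km False by (simp add: power2_eq_square ac_simps)
    finally show ?thesis by (rule order_trans) simp
  qed
  finally show ?thesis by (rule order_trans) simp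
qed

text \<open>
  A pair of paths with \<open>n\<close> transitions has fewer than \<open>k\<close> transitions inside \<open>C \<times> C\<close> only if it is
  outside \<open>C \<times> C\<close> at more than \<open>(n - k) / 2\<close> times, because each such time spoils at most two
  transitions.  The initial state spoils only one, hence the extra unit in the last assumption,
  which is what makes the induction work.
\<close>

lemma weight_forgetting:
  fixes \<eta> :: ennreal and em ep :: real and y :: "nat \<Rightarrow> 'y"
  assumes LD: "LD_set_with X Q C \<Lambda> em ep"
    and \<eta>: "\<And>z. z \<in> K \<Longrightarrow> Upsilon Q g V (space X - C) z \<le> \<eta> * Ups z"
    and \<eta>_fin: "\<eta> < \<infinity>"
    and f[measurable]: "f \<in> borel_measurable X" and f_le: "\<And>z. z \<in> space X \<Longrightarrow> f z \<le> 1"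
    and "\<And>i. y i \<in> space Y" "\<And>i. Ups (y i) < \<infinity>" "x \<in> space X" "x' \<in> space X"
    and "k + 2 * m + 2 * (\<Sum>i\<le>n. if y i \<in> K then 0 else 1) \<le> n + (if x \<in> C \<and> x' \<in> C then 0 else 1)"
  shows "weight n y f x * weight n y (\<lambda>_. 1) x' \<le> weight n y (\<lambda>_. 1) x * weight n y f x' +
    (ennreal (1 - (em / ep)\<^sup>2) ^ k * (weight n y (\<lambda>_. 1) x * weight n y (\<lambda>_. 1) x') +
     \<eta> ^ m * ((\<Prod>i\<le>n. Ups (y i))\<^sup>2 * (ennreal (V x) * ennreal (V x'))))"
  using assms(6-10)
proof (induction n arbitrary: y x x' k m)
  case 0
  \<comment> \<open>The budget is at most 1 here, and \<open>m\<close> counts twice.\<close>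
  have "m = 0" using 0(5) by (auto split: if_splits)
  then show ?case using 0 by (intro weight_forgetting_trivial f_le) auto
next
  case (Suc n)
  let ?\<rho> = "ennreal (1 - (em / ep)\<^sup>2)"
  show ?case
  proof (cases "k = 0 \<or> m = 0")
    case True
    then show ?thesis using Suc.prems by (intro weight_forgetting_trivial f_le) auto
  next
    case False
    define sy where "sy i = y (Suc i)" for i
    define a where "a = weight n sy f"
    define b where "b = weight n sy (\<lambda>_. 1)"
    define c where "c = (\<Prod>i\<le>n. Ups (sy i))\<^sup>2"
    \<comment> \<open>The error as a function of the pair of next states. The exponents stay open
      because they depend on where the pair lands.\<close>
    define B where "B k m z = ?\<rho> ^ k * (b (fst z) * b (snd z)) +
      \<eta> ^ m * (c * (ennreal (V (fst z)) * ennreal (V (snd z))))" for k m z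
    have sy: "sy i \<in> space Y" "Ups (sy i) < \<infinity>" for i
      using Suc.prems unfolding sy_def by auto
    note x = Suc.prems(3,4)
    note kx = kernel[OF x(1)] and kx' = kernel[OF x(2)]
    interpret Q: prob_space "Q x" by (rule kx)
    interpret Q': prob_space "Q x'" by (rule kx')
    note [measurable_cong] = kx(1) kx'(1)
    have [measurable]: "a \<in> borel_measurable X" "b \<in> borel_measurable X"
      unfolding a_def b_def using sy f by (auto intro!: measurable_weight)
    have IH: "a z * b z' \<le> b z * a z' + B j l (z, z')"
      if "z \<in> space X" "z' \<in> space X" "j + 2 * l + 2 * (\<Sum>i\<le>n. if sy i \<in> K then 0 else 1) \<le>
         n + (if z \<in> C \<and> z' \<in> C then 0 else 1)" for z z' j l
      using Suc.IH[of sy z z' j l] sy that unfolding a_def b_def c_def B_def by simp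
    have step: "weight (Suc n) y f v = ennreal (g v (y 0)) * (\<integral>\<^sup>+z. a z \<partial>Q v)"
      "weight (Suc n) y (\<lambda>_. 1) v = ennreal (g v (y 0)) * (\<integral>\<^sup>+z. b z \<partial>Q v)" for v
      unfolding a_def b_def sy_def weight_Suc by auto
    \<comment> \<open>Common end of both cases. One use of the drift turns
      \<open>QV x * QV x'\<close> into the missing Upsilon and V factors at a cost
      \<open>\<theta>\<close>: this is 1 if the pair is in C x C or the observation is outside
      \<open>K\<close>, and \<eta> otherwise, so that \<eta>^l grows to \<eta>^m.\<close>
    have combine: ?thesis
      if le: "(\<integral>\<^sup>+z. a z \<partial>Q x) * (\<integral>\<^sup>+z. b z \<partial>Q x') \<le> (\<integral>\<^sup>+z. b z \<partial>Q x) * (\<integral>\<^sup>+z. a z \<partial>Q x') +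
          (?\<rho> ^ k * ((\<integral>\<^sup>+z. b z \<partial>Q x) * (\<integral>\<^sup>+z. b z \<partial>Q x')) + \<eta> ^ l * (c * (QV x * QV x')))"
        and th: "(ennreal (g x (y 0)) * QV x) * (ennreal (g x' (y 0)) * QV x') \<le>
          \<theta> * ((Ups (y 0))\<^sup>2 * (ennreal (V x) * ennreal (V x')))" "\<eta> ^ l * \<theta> = \<eta> ^ m"
      for l \<theta>
    proof -
      let ?G = "ennreal (g x (y 0)) * ennreal (g x' (y 0))"
      have "\<eta> ^ l * (c * (?G * (QV x * QV x'))) \<le>
          \<eta> ^ l * (c * (\<theta> * ((Ups (y 0))\<^sup>2 * (ennreal (V x) * ennreal (V x')))))"
        using th(1) by (intro mult_left_mono) (simp_all add: ac_simps)
      also have "\<dots> = \<eta> ^ m * ((\<Prod>i\<le>Suc n. Ups (y i))\<^sup>2 * (ennreal (V x) * ennreal (V x')))"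
        unfolding th(2)[symmetric] c_def sy_def
        by (simp add: prod.atMost_Suc_shift power_mult_distrib ac_simps del: prod.atMost_Suc)
      finally have last: "\<eta> ^ l * (c * (?G * (QV x * QV x'))) \<le>
          \<eta> ^ m * ((\<Prod>i\<le>Suc n. Ups (y i))\<^sup>2 * (ennreal (V x) * ennreal (V x')))" .
      have "weight (Suc n) y f x * weight (Suc n) y (\<lambda>_. 1) x' =
          ?G * ((\<integral>\<^sup>+z. a z \<partial>Q x) * (\<integral>\<^sup>+z. b z \<partial>Q x'))"
        unfolding step by (simp add: ac_simps)
      also have "\<dots> \<le> ?G * ((\<integral>\<^sup>+z. b z \<partial>Q x) * (\<integral>\<^sup>+z. a z \<partial>Q x') +
          (?\<rho> ^ k * ((\<integral>\<^sup>+z. b z \<partial>Q x) * (\<integral>\<^sup>+z. b z \<partial>Q x')) + \<eta> ^ l * (c * (QV x * QV x'))))"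
        by (intro mult_left_mono le) simp
      also have "\<dots> = weight (Suc n) y (\<lambda>_. 1) x * weight (Suc n) y f x' +
          (?\<rho> ^ k * (weight (Suc n) y (\<lambda>_. 1) x * weight (Suc n) y (\<lambda>_. 1) x') +
           \<eta> ^ l * (c * (?G * (QV x * QV x'))))"
        unfolding step by (simp add: distrib_left ac_simps)
      also have "\<dots> \<le> weight (Suc n) y (\<lambda>_. 1) x * weight (Suc n) y f x' +
          (?\<rho> ^ k * (weight (Suc n) y (\<lambda>_. 1) x * weight (Suc n) y (\<lambda>_. 1) x') +
           \<eta> ^ m * ((\<Prod>i\<le>Suc n. Ups (y i))\<^sup>2 * (ennreal (V x) * ennreal (V x'))))"
        by (intro add_left_mono last)
      finally show ?thesis .
    qed
    have meas_B[measurable]: "B j l \<in> borel_measurable (X \<Otimes>\<^sub>M X)" for j l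
      unfolding B_def[abs_def] by measurable
    have int_B: "(\<integral>\<^sup>+z. B j l z \<partial>(Q x \<Otimes>\<^sub>M Q x')) =
       ?\<rho> ^ j * ((\<integral>\<^sup>+z. b z \<partial>Q x) * (\<integral>\<^sup>+z. b z \<partial>Q x')) + \<eta> ^ l * (c * (QV x * QV x'))" for j l
      using nn_integral_pair_mult[of "Q x'" "\<lambda>z. ennreal (V z)" "Q x" "\<lambda>z. ennreal (V z)"]
      unfolding B_def
      by (simp add: nn_integral_add nn_integral_cmult nn_integral_pair_mult Q'.sigma_finite_measure_axioms)
    have drift_all: "(ennreal (g x (y 0)) * QV x) * (ennreal (g x' (y 0)) * QV x') \<le>
          1 * ((Ups (y 0))\<^sup>2 * (ennreal (V x) * ennreal (V x')))"
      using mult_mono[OF drift[of x "space X" "y 0"] drift[of x' "space X" "y 0"]] x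
      by (simp add: power2_eq_square ac_simps)
    have cnt: "(\<Sum>i\<le>Suc n. if y i \<in> K then 0 else 1) =
        (if y 0 \<in> K then 0 else 1) + (\<Sum>i\<le>n. if sy i \<in> K then 0 else (1::nat))"
      unfolding sy_def by (simp add: sum.atMost_Suc_shift del: sum.atMost_Suc)
    note budget = Suc.prems(5)[unfolded cnt]
    show ?thesis
    proof (cases "x \<in> C \<and> x' \<in> C")
      case True
      \<comment> \<open>A pair that lands in C x C again uses one unit of the budget, so the
        hypothesis is available only for \<open>k - 1\<close>; the coupling restores the lost
        factor. A pair that leaves C x C enjoys the extra unit and keeps \<open>k\<close>.\<close>
      define w where "w z = (if z \<in> C \<times> C then B (k - 1) m z else B k m z)" for z
      have [measurable]: "C \<in> sets X" using LD by (simp add: LD_set_with_def)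
      have [measurable]: "w \<in> borel_measurable (X \<Otimes>\<^sub>M X)"
        unfolding w_def[abs_def] by measurable
      have QV: "QV x < \<infinity>" "QV x' < \<infinity>"
        using QV_finite[of _ "y 0"] Suc.prems by auto
      have prod_fin: "(\<Prod>i\<le>n. Ups (sy i)) < \<infinity>"
        using sy(2) by (simp add: ennreal_prod_less_top)
      have b_fin: "(\<integral>\<^sup>+z. b z \<partial>Q v) < \<infinity>" if "v = x \<or> v = x'" for v
      proof -
        have v: "v \<in> space X" using x that by auto
        note [measurable_cong] = kernel(1)[OF v]
        have "(\<integral>\<^sup>+z. b z \<partial>Q v) \<le> (\<integral>\<^sup>+z. (\<Prod>i\<le>n. Ups (sy i)) * ennreal (V z) \<partial>Q v)"
          unfolding b_def using kernel[OF v] by (intro nn_integral_mono weight_le) simp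
        also have "\<dots> = (\<Prod>i\<le>n. Ups (sy i)) * QV v"
          by (simp add: nn_integral_cmult)
        also have "\<dots> < \<infinity>"
          using QV that prod_fin by (auto simp: ennreal_mult_less_top)
        finally show ?thesis .
      qed
      have "(\<integral>\<^sup>+z. a z \<partial>Q x) \<le> (\<integral>\<^sup>+z. b z \<partial>Q x)"
        unfolding a_def b_def using kx f_le by (intro nn_integral_mono weight_mono) auto
      then have a_fin: "(\<integral>\<^sup>+z. a z \<partial>Q x) < \<infinity>" using b_fin[of x] by auto
      have B_fin: "(\<integral>\<^sup>+z. B j m z \<partial>(Q x \<Otimes>\<^sub>M Q x')) < \<infinity>" for j
        unfolding int_B c_def using b_fin QV prod_fin \<eta>_fin
        by (simp add: ennreal_mult_less_top power_less_top_ennreal)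
      have "(\<integral>\<^sup>+z. w z \<partial>(Q x \<Otimes>\<^sub>M Q x')) \<le> (\<integral>\<^sup>+z. B (k - 1) m z + B k m z \<partial>(Q x \<Otimes>\<^sub>M Q x'))"
        by (intro nn_integral_mono) (simp add: w_def)
      also have "\<dots> < \<infinity>"
        using B_fin by (simp add: nn_integral_add)
      finally have w_fin: "(\<integral>\<^sup>+z. w z \<partial>(Q x \<Otimes>\<^sub>M Q x')) < \<infinity>" .
      have w: "a z * b z' \<le> b z * a z' + w (z, z')" if "z \<in> space X" "z' \<in> space X" for z z'
        using budget True \<open>\<not> (k = 0 \<or> m = 0)\<close> that IH[of z z' "k - 1" m] IH[of z z' k m]
        unfolding w_def by (auto split: if_splits)
      \<comment> \<open>The factor \<open>?\<rho>\<close> is used up in the first summand, from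
        exponent \<open>k - 1\<close> to \<open>k\<close>; in the second only
        \<open>?\<rho> \<le> 1\<close> is needed.\<close>
      have \<rho>_w: "(if z \<in> C \<times> C then ?\<rho> else 1) * w z \<le> B k m z" for z
      proof (cases "z \<in> C \<times> C")
        case True
        have "?\<rho> * (\<eta> ^ m * (c * (ennreal (V (fst z)) * ennreal (V (snd z))))) \<le>
            1 * (\<eta> ^ m * (c * (ennreal (V (fst z)) * ennreal (V (snd z)))))"
          by (intro mult_right_mono) auto
        moreover have "?\<rho> ^ k = ?\<rho> * ?\<rho> ^ (k - 1)"
          using \<open>\<not> (k = 0 \<or> m = 0)\<close> by (cases k) auto
        ultimately show ?thesis
          using True unfolding w_def B_def by (simp add: distrib_left mult.assoc)
      qed (simp add: w_def)
      have "(\<integral>\<^sup>+z. a z \<partial>Q x) * (\<integral>\<^sup>+z. b z \<partial>Q x') \<le> (\<integral>\<^sup>+z. b z \<partial>Q x) * (\<integral>\<^sup>+z. a z \<partial>Q x') +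
          (\<integral>\<^sup>+z. (if z \<in> C \<times> C then ?\<rho> else 1) * w z \<partial>(Q x \<Otimes>\<^sub>M Q x'))"
        using True w a_fin b_fin w_fin by (intro LD_coupling_step[OF LD]) auto
      also have "\<dots> \<le> (\<integral>\<^sup>+z. b z \<partial>Q x) * (\<integral>\<^sup>+z. a z \<partial>Q x') + (\<integral>\<^sup>+z. B k m z \<partial>(Q x \<Otimes>\<^sub>M Q x'))"
        by (intro add_left_mono nn_integral_mono \<rho>_w)
      finally show ?thesis
        unfolding int_B using drift_all by (rule combine) simp
    next
      case False
      \<comment> \<open>Moving on loses one unit of the budget for the transition and possibly the
        extra unit. Both are covered: for \<open>y 0\<close> in \<open>K\<close> by lowering
        \<open>m\<close> by one, otherwise by the term that counts visits outside \<open>K\<close>.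
        So \<open>k\<close> is kept even if the pair lands in C x C.\<close>
      define l where "l = (if y 0 \<in> K then m - 1 else m)"
      define \<theta> where "\<theta> = (if y 0 \<in> K then \<eta> else 1)"
      have "(\<integral>\<^sup>+z. a z \<partial>Q x) * (\<integral>\<^sup>+z. b z \<partial>Q x') = (\<integral>\<^sup>+z. a (fst z) * b (snd z) \<partial>(Q x \<Otimes>\<^sub>M Q x'))"
        by (simp add: nn_integral_pair_mult Q'.sigma_finite_measure_axioms)
      also have "\<dots> \<le> (\<integral>\<^sup>+z. b (fst z) * a (snd z) + B k l z \<partial>(Q x \<Otimes>\<^sub>M Q x'))"
      proof (intro nn_integral_mono)
        fix z assume "z \<in> space (Q x \<Otimes>\<^sub>M Q x')"
        then show "a (fst z) * b (snd z) \<le> b (fst z) * a (snd z) + B k l z"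
          using budget False \<open>\<not> (k = 0 \<or> m = 0)\<close> IH[of "fst z" "snd z" k l] kx kx'
          by (auto simp: space_pair_measure l_def split: if_splits)
      qed
      also have "\<dots> = (\<integral>\<^sup>+z. b z \<partial>Q x) * (\<integral>\<^sup>+z. a z \<partial>Q x') + (\<integral>\<^sup>+z. B k l z \<partial>(Q x \<Otimes>\<^sub>M Q x'))"
        by (simp add: nn_integral_add nn_integral_pair_mult Q'.sigma_finite_measure_axioms)
      finally have le: "(\<integral>\<^sup>+z. a z \<partial>Q x) * (\<integral>\<^sup>+z. b z \<partial>Q x') \<le>
        (\<integral>\<^sup>+z. b z \<partial>Q x) * (\<integral>\<^sup>+z. a z \<partial>Q x') + (\<integral>\<^sup>+z. B k l z \<partial>(Q x \<Otimes>\<^sub>M Q x'))" .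
      have "(ennreal (g x (y 0)) * QV x) * (ennreal (g x' (y 0)) * QV x') \<le>
          \<theta> * ((Ups (y 0))\<^sup>2 * (ennreal (V x) * ennreal (V x')))"
      proof (cases "y 0 \<in> K")
        case True
        \<comment> \<open>It is enough that one coordinate is outside \<open>C\<close>: that one
          gains \<eta>, the other is bounded by \<open>all\<close>.\<close>
        have out: "ennreal (g v (y 0)) * QV v \<le> \<eta> * Ups (y 0) * ennreal (V v)"
          if "v \<notin> C" "v \<in> space X" for v
          using drift[of v "space X - C" "y 0"] that mult_right_mono[OF \<eta>[OF True], of "ennreal (V v)"]
          by (auto intro: order_trans)
        have all: "ennreal (g v (y 0)) * QV v \<le> Ups (y 0) * ennreal (V v)" if "v \<in> space X" for v
          using drift that by auto
        consider "x \<notin> C" | "x' \<notin> C" using False by auto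
        then show ?thesis
        proof cases
          case 1
          have "(ennreal (g x (y 0)) * QV x) * (ennreal (g x' (y 0)) * QV x') \<le>
              (\<eta> * Ups (y 0) * ennreal (V x)) * (Ups (y 0) * ennreal (V x'))"
            using 1 x by (intro mult_mono out all) auto
          then show ?thesis using True by (simp add: \<theta>_def power2_eq_square ac_simps)
        next
          case 2
          have "(ennreal (g x (y 0)) * QV x) * (ennreal (g x' (y 0)) * QV x') \<le>
              (Ups (y 0) * ennreal (V x)) * (\<eta> * Ups (y 0) * ennreal (V x'))"
            using 2 x by (intro mult_mono out all) auto
          then show ?thesis using True by (simp add: \<theta>_def power2_eq_square ac_simps)
        qed
      qed (use drift_all in \<open>simp add: \<theta>_def\<close>)
      moreover have "\<eta> ^ l * \<theta> = \<eta> ^ m"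
        using \<open>\<not> (k = 0 \<or> m = 0)\<close> by (cases m) (auto simp: l_def \<theta>_def mult.commute)
      ultimately show ?thesis
        using le[unfolded int_B] by (rule combine[rotated])
    qed
  qed
qed

section \<open>Bounds for the filtering distributions\<close>

text \<open>The error is a sum of products in the two coordinates, so integrating against \<nu> x
  \<nu>' yields products of integrals. The budget omits the extra unit for the initial pair and thus
  fits every starting pair.\<close>

lemma path_integral_forgetting:
  fixes \<eta> :: ennreal and em ep :: real and y :: "nat \<Rightarrow> 'y"
  assumes LD: "LD_set_with X Q C \<Lambda> em ep"
    and \<eta>: "\<And>z. z \<in> K \<Longrightarrow> Upsilon Q g V (space X - C) z \<le> \<eta> * Ups z" "\<eta> < \<infinity>"
    and f: "f \<in> borel_measurable X" "\<And>z. z \<in> space X \<Longrightarrow> f z \<le> 1"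
    and y: "\<And>i. y i \<in> space Y" "\<And>i. Ups (y i) < \<infinity>"
    and budget: "k + 2 * m + 2 * (\<Sum>i\<le>n. if y i \<in> K then 0 else 1) \<le> n"
    and \<nu>: "sets \<nu> = sets X" "sets \<nu>' = sets X" "prob_space \<nu>'"
  shows "path_integral Q g n y f \<nu> * path_integral Q g n y (\<lambda>_. 1) \<nu>' \<le>
    path_integral Q g n y (\<lambda>_. 1) \<nu> * path_integral Q g n y f \<nu>' +
    (ennreal (1 - (em / ep)\<^sup>2) ^ k *
       (path_integral Q g n y (\<lambda>_. 1) \<nu> * path_integral Q g n y (\<lambda>_. 1) \<nu>') +
     \<eta> ^ m * ((\<Prod>i\<le>n. Ups (y i))\<^sup>2 * ((\<integral>\<^sup>+x. V x \<partial>\<nu>) * (\<integral>\<^sup>+x. V x \<partial>\<nu>'))))"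
proof -
  interpret prob_space \<nu>' by fact
  note [measurable_cong] = \<nu>(1,2)
  note pair = nn_integral_pair_mult[OF sigma_finite_measure_axioms, of _ \<nu>]
  have sp: "space \<nu> = space X" "space \<nu>' = space X"
    using sets_eq_imp_space_eq[OF \<nu>(1)] sets_eq_imp_space_eq[OF \<nu>(2)] .
  define a where "a = weight n y f"
  define b where "b = weight n y (\<lambda>_. 1)"
  have [measurable]: "a \<in> borel_measurable X" "b \<in> borel_measurable X"
    unfolding a_def b_def using f y by (auto intro: measurable_weight)
  let ?\<rho> = "ennreal (1 - (em / ep)\<^sup>2) ^ k" and ?c = "(\<Prod>i\<le>n. Ups (y i))\<^sup>2"
  have "(\<integral>\<^sup>+x. a x \<partial>\<nu>) * (\<integral>\<^sup>+x. b x \<partial>\<nu>') = (\<integral>\<^sup>+z. a (fst z) * b (snd z) \<partial>(\<nu> \<Otimes>\<^sub>M \<nu>'))"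
    by (simp add: pair)
  also have "\<dots> \<le> (\<integral>\<^sup>+z. b (fst z) * a (snd z) + (?\<rho> * (b (fst z) * b (snd z)) +
      \<eta> ^ m * (?c * (ennreal (V (fst z)) * ennreal (V (snd z))))) \<partial>(\<nu> \<Otimes>\<^sub>M \<nu>'))"
  proof (intro nn_integral_mono)
    fix z assume "z \<in> space (\<nu> \<Otimes>\<^sub>M \<nu>')"
    then have z: "fst z \<in> space X" "snd z \<in> space X"
      by (auto simp: space_pair_measure sp)
    show "a (fst z) * b (snd z) \<le> b (fst z) * a (snd z) + (?\<rho> * (b (fst z) * b (snd z)) +
      \<eta> ^ m * (?c * (ennreal (V (fst z)) * ennreal (V (snd z)))))"
      unfolding a_def b_def
      using budget by (intro weight_forgetting[OF LD \<eta> f y z]) auto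
  qed
  also have "\<dots> = (\<integral>\<^sup>+x. b x \<partial>\<nu>) * (\<integral>\<^sup>+x. a x \<partial>\<nu>') +
      (?\<rho> * ((\<integral>\<^sup>+x. b x \<partial>\<nu>) * (\<integral>\<^sup>+x. b x \<partial>\<nu>')) +
      \<eta> ^ m * (?c * ((\<integral>\<^sup>+x. V x \<partial>\<nu>) * (\<integral>\<^sup>+x. V x \<partial>\<nu>'))))"
    using pair[of "\<lambda>z. ennreal (V z)" "\<lambda>z. ennreal (V z)"]
    by (simp add: nn_integral_add nn_integral_cmult pair)
  finally show ?thesis
    unfolding path_integral_eq_weight a_def b_def .
qed

lemma path_integral_1_le:
  assumes "sets \<nu> = sets X"
  shows "path_integral Q g n y (\<lambda>_. 1) \<nu> \<le> (\<Prod>i\<le>n. Ups (y i)) * (\<integral>\<^sup>+x. V x \<partial>\<nu>)"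
proof -
  note [measurable_cong] = assms
  have "path_integral Q g n y (\<lambda>_. 1) \<nu> \<le> (\<integral>\<^sup>+x. (\<Prod>i\<le>n. Ups (y i)) * ennreal (V x) \<partial>\<nu>)"
    unfolding path_integral_eq_weight using sets_eq_imp_space_eq[OF assms]
    by (intro nn_integral_mono weight_le) simp
  then show ?thesis by (simp add: nn_integral_cmult)
qed

text \<open>The error does not depend on the event, so it survives the supremum; it is symmetric in
  the two measures, so comparing them in both orders bounds the absolute difference.\<close>

lemma tv_dist_filtering_le:
  fixes \<eta> :: ennreal and em ep :: real and y :: "nat \<Rightarrow> 'y"
  assumes LD: "LD_set_with X Q C \<Lambda> em ep"
    and \<eta>: "\<And>z. z \<in> K \<Longrightarrow> Upsilon Q g V (space X - C) z \<le> \<eta> * Ups z" "\<eta> < \<infinity>"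
    and y: "\<And>i. y i \<in> space Y" "\<And>i. Ups (y i) < \<infinity>"
    and budget: "k + 2 * m + 2 * (\<Sum>i\<le>n. if y i \<in> K then 0 else 1) \<le> n"
    and \<nu>: "sets \<nu> = sets X" "prob_space \<nu>" "(\<integral>\<^sup>+x. V x \<partial>\<nu>) < \<infinity>"
    and \<nu>': "sets \<nu>' = sets X" "prob_space \<nu>'" "(\<integral>\<^sup>+x. V x \<partial>\<nu>') < \<infinity>"
    and pos: "0 < path_integral Q g n y (\<lambda>_. 1) \<nu>" "0 < path_integral Q g n y (\<lambda>_. 1) \<nu>'"
  shows "tv_dist (filtering_dist Q g \<nu> n y) (filtering_dist Q g \<nu>' n y) \<le>
    ennreal (1 - (em / ep)\<^sup>2) ^ k +
    \<eta> ^ m * ((\<Prod>i\<le>n. Ups (y i))\<^sup>2 * ((\<integral>\<^sup>+x. V x \<partial>\<nu>) * (\<integral>\<^sup>+x. V x \<partial>\<nu>'))) /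
      (path_integral Q g n y (\<lambda>_. 1) \<nu> * path_integral Q g n y (\<lambda>_. 1) \<nu>')" (is "_ \<le> ?R")
proof -
  let ?N = "path_integral Q g n y (\<lambda>_. 1)"
  have U: "(\<Prod>i\<le>n. Ups (y i)) < top"
    using y by (intro ennreal_prod_less_top) simp
  have N_fin: "?N \<nu> < top" "?N \<nu>' < top"
    using path_integral_1_le[OF \<nu>(1), of n y] path_integral_1_le[OF \<nu>'(1), of n y] U \<nu>(3) \<nu>'(3)
    by (auto simp: ennreal_mult_less_top intro: le_less_trans)
  have "\<eta> ^ m * ((\<Prod>i\<le>n. Ups (y i))\<^sup>2 * ((\<integral>\<^sup>+x. V x \<partial>\<nu>) * (\<integral>\<^sup>+x. V x \<partial>\<nu>'))) < top"
    using U \<eta>(2) \<nu>(3) \<nu>'(3) by (simp add: ennreal_mult_less_top power_less_top_ennreal)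
  \<comment> \<open>A finite bound permits the passage from \<open>emeasure\<close> to the real
    differences in \<open>tv_dist\<close>.\<close>
  then have R: "?R \<noteq> top"
    using pos by (auto simp: ennreal_divide_eq_top_iff power_eq_top_ennreal)
  have le: "emeasure (filtering_dist Q g \<mu> n y) A \<le> emeasure (filtering_dist Q g \<mu>' n y) A +
      (ennreal (1 - (em / ep)\<^sup>2) ^ k + \<eta> ^ m * ((\<Prod>i\<le>n. Ups (y i))\<^sup>2 *
        ((\<integral>\<^sup>+x. V x \<partial>\<mu>) * (\<integral>\<^sup>+x. V x \<partial>\<mu>'))) / (?N \<mu> * ?N \<mu>'))"
    if A: "A \<in> sets X" and \<mu>: "sets \<mu> = sets X" "sets \<mu>' = sets X" "prob_space \<mu>'"
      "0 < ?N \<mu>" "?N \<mu> < top" "0 < ?N \<mu>'" "?N \<mu>' < top" for A \<mu> \<mu>'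
    unfolding emeasure_filtering_dist[OF Q g y(1) \<mu>(1) A] emeasure_filtering_dist[OF Q g y(1) \<mu>(2) A]
    by (intro ennreal_quotient_le[OF _ \<mu>(4-7)] path_integral_forgetting[where K=K, OF LD _ \<eta>(2) _ _ y budget \<mu>(1-3)])
      (use A \<eta> in \<open>auto simp: indicator_def[abs_def]\<close>)
  show ?thesis
    unfolding tv_dist_def
  proof (rule SUP_least)
    fix A assume "A \<in> sets (filtering_dist Q g \<nu> n y)"
    moreover have "sets (filtering_dist Q g \<nu> n y) = sets \<nu>"
      by (simp add: filtering_dist_def)
    ultimately have A: "A \<in> sets X"
      using \<nu>(1) by simp
    have fin: "emeasure (filtering_dist Q g \<mu> n y) A < top"
      if "sets \<mu> = sets X" "0 < ?N \<mu>" "?N \<mu> < top" for \<mu>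
    proof -
      have "path_integral Q g n y (indicator A) \<mu> \<le> ?N \<mu>"
        unfolding path_integral_eq_weight using sets_eq_imp_space_eq[OF that(1)]
        by (intro nn_integral_mono weight_mono) (auto simp: indicator_def)
      then show ?thesis
        using that emeasure_filtering_dist[OF Q g y(1) that(1) A, of n]
        by (auto simp: ennreal_divide_eq_top_iff less_top[symmetric] top_unique)
    qed
    obtain r where r: "?R = ennreal r" "0 \<le> r"
      using R by (cases "?R") auto
    then have r': "ennreal (1 - (em / ep)\<^sup>2) ^ k + \<eta> ^ m * ((\<Prod>i\<le>n. Ups (y i))\<^sup>2 *
        ((\<integral>\<^sup>+x. V x \<partial>\<nu>') * (\<integral>\<^sup>+x. V x \<partial>\<nu>))) / (?N \<nu>' * ?N \<nu>) = ennreal r"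
      by (simp add: mult.commute)
    have "emeasure (filtering_dist Q g \<nu> n y) A = ennreal (measure (filtering_dist Q g \<nu> n y) A)"
         "emeasure (filtering_dist Q g \<nu>' n y) A = ennreal (measure (filtering_dist Q g \<nu>' n y) A)"
      using fin[OF \<nu>(1) pos(1) N_fin(1)] fin[OF \<nu>'(1) pos(2) N_fin(2)]
      by (auto intro!: emeasure_eq_ennreal_measure)
    then have "\<bar>measure (filtering_dist Q g \<nu> n y) A - measure (filtering_dist Q g \<nu>' n y) A\<bar> \<le> r"
      using le[OF A \<nu>(1) \<nu>'(1,2) pos(1) N_fin(1) pos(2) N_fin(2)]
        le[OF A \<nu>'(1) \<nu>(1,2) pos(2) N_fin(2) pos(1) N_fin(1)] r(2)
      unfolding r(1) r'
      by (simp add: ennreal_le_iff abs_le_iff algebra_simps flip: ennreal_plus)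
    then show "ennreal \<bar>measure (filtering_dist Q g \<nu> n y) A - measure (filtering_dist Q g \<nu>' n y) A\<bar> \<le> ?R"
      unfolding r(1) by (rule ennreal_leI)
  qed
qed

section \<open>Lower bounds for the normalising constants\<close>

text \<open>Positivity comes from g > 0 on a set of positive mass. For finiteness pick x in D: the
  integral of g over D under \<open>\<Lambda>\<close> is controlled by that under
  \<open>Q x\<close>, and the drift bounds the latter by \<open>Ups y * QV x\<close>. Sums of
  logarithms of \<open>Psi\<close> thus contain no infinite terms.\<close>

lemma Psi_bounds:
  assumes LD: "LD_set_with X Q D \<Lambda> em ep" and y: "y \<in> space Y"
  shows "0 < Psi g \<Lambda> D y" and "Ups y < \<infinity> \<Longrightarrow> Psi g \<Lambda> D y < \<infinity>"
proof -
  have D[measurable]: "D \<in> sets X" and \<Lambda>[measurable_cong]: "sets \<Lambda> = sets X"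
    and e: "0 < em" and mass: "0 < emeasure \<Lambda> D"
    using LD unfolding LD_set_with_def by auto
  note g_y[measurable] = measurable_g_section[OF Q g y]
  have DX: "D \<subseteq> space X" using D sets.sets_into_space by blast
  show "0 < Psi g \<Lambda> D y"
  proof (rule ccontr)
    assume "\<not> 0 < Psi g \<Lambda> D y"
    then have "AE x in \<Lambda>. ennreal (g x y) * indicator D x = 0"
      unfolding Psi_def by (subst nn_integral_0_iff_AE[symmetric]) simp_all
    then have "AE x in \<Lambda>. x \<notin> D"
    proof eventually_elim
      case (elim x)
      then show ?case
        using g_pos[of x y] y DX by (auto simp: indicator_def split: if_splits)
    qed
    then show False
      using mass D \<Lambda> sets.sets_into_space[of D \<Lambda>] by (subst (asm) AE_iff_measurable[of D]) auto
  qed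
  assume U: "Ups y < \<infinity>"
  obtain x where x: "x \<in> D" using LD_mass(1)[OF LD] by auto
  then have xX: "x \<in> space X" using DX by auto
  note [measurable_cong] = kernel(1)[OF xX]
  have "ennreal em * Psi g \<Lambda> D y \<le> (\<integral>\<^sup>+z\<in>D. ennreal (g z y) \<partial>Q x)"
    unfolding Psi_def by (rule LD_nn_integral(1)[OF LD x]) simp
  also have "\<dots> \<le> (\<integral>\<^sup>+z. Ups y * ennreal (V z) \<partial>Q x)"
  proof (rule nn_integral_mono)
    fix z assume "z \<in> space (Q x)"
    then have z: "z \<in> space X" using kernel[OF xX] by simp
    have "ennreal (g z y) * indicator D z \<le> ennreal (g z y) * QV z"
      using QV_ge_1[OF z] by (intro mult_left_mono) (auto simp: indicator_def)
    also have "\<dots> \<le> Ups y * ennreal (V z)" using z by (intro drift)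
    finally show "ennreal (g z y) * indicator D z \<le> Ups y * ennreal (V z)" .
  qed
  also have "\<dots> = Ups y * QV x" by (simp add: nn_integral_cmult)
  also have "\<dots> < \<infinity>" using U QV_finite[OF xX y U] by (simp add: ennreal_mult_less_top)
  finally show "Psi g \<Lambda> D y < \<infinity>" using e by (auto simp: ennreal_mult_less_top)
qed

text \<open>The state at time 0 is itself reached by a transition out of \<open>D\<close>, so each
  of the n + 1 observations contributes the same kind of factor.\<close>

lemma path_integral_ge_LD:
  assumes LD: "LD_set_with X Q D \<Lambda> em ep" and x: "x \<in> D" and "\<And>i. y i \<in> space Y"
  shows "(\<Prod>i\<le>n. ennreal em * Psi g \<Lambda> D (y i)) \<le> path_integral Q g n y (\<lambda>_. 1) (Q x)"
  using x assms(3)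
proof (induction n arbitrary: x y)
  have D: "D \<in> sets X" using LD unfolding LD_set_with_def by auto
  have step: "ennreal em * Psi g \<Lambda> D (y 0) * p \<le> (\<integral>\<^sup>+z. ennreal (g z (y 0)) * q z \<partial>Q x)"
    if "x \<in> D" "y 0 \<in> space Y" "\<And>z. z \<in> D \<Longrightarrow> p \<le> q z" for x p q and y :: "nat \<Rightarrow> 'y"
  proof -
    note [measurable] = measurable_g_section[OF Q g that(2)] D
    have "x \<in> space X" using that(1) sets.sets_into_space[OF D] by auto
    note [measurable_cong] = kernel(1)[OF this]
    have "ennreal em * Psi g \<Lambda> D (y 0) * p \<le> (\<integral>\<^sup>+z\<in>D. ennreal (g z (y 0)) \<partial>Q x) * p"
      unfolding Psi_def by (intro mult_right_mono LD_nn_integral(1)[OF LD that(1)]) simp_all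
    also have "\<dots> = (\<integral>\<^sup>+z. ennreal (g z (y 0)) * indicator D z * p \<partial>Q x)"
      by (simp add: nn_integral_multc)
    also have "\<dots> \<le> (\<integral>\<^sup>+z. ennreal (g z (y 0)) * q z \<partial>Q x)"
      using that(3) by (intro nn_integral_mono) (auto simp: indicator_def intro: mult_left_mono)
    finally show ?thesis .
  qed
  {
    case 0
    then show ?case using step[of x y 1 "\<lambda>_. 1"] by simp
  next
    case (Suc n)
    have "(\<Prod>i\<le>Suc n. ennreal em * Psi g \<Lambda> D (y i)) =
        ennreal em * Psi g \<Lambda> D (y 0) * (\<Prod>i\<le>n. ennreal em * Psi g \<Lambda> D (y (Suc i)))"
      by (rule prod.atMost_Suc_shift)
    also have "\<dots> \<le> path_integral Q g (Suc n) y (\<lambda>_. 1) (Q x)"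
      unfolding path_integral.simps using Suc.prems by (intro step Suc.IH) auto
    finally show ?case .
  }
qed

text \<open>\<nu> need not charge \<open>D\<close>; only its image under Q does. So the state at
  time 0 is left free, the state at time 1 is required to be in \<open>D\<close>, and the first two
  observations go into the constant, which leaves the product from 2 on.\<close>

lemma path_integral_ge:
  assumes LD: "LD_set_with X Q D \<Lambda> em ep" and y: "\<And>i. y i \<in> space Y"
    and \<nu>: "sets \<nu> = sets X" and pos: "0 < (\<integral>\<^sup>+x. emeasure (Q x) D \<partial>\<nu>)"
  obtains c :: real where "0 < c"
    "\<And>n. n \<ge> 2 \<Longrightarrow> ennreal c * (\<Prod>i=2..n. ennreal em * Psi g \<Lambda> D (y i)) \<le> path_integral Q g n y (\<lambda>_. 1) \<nu>"
proof -
  have D[measurable]: "D \<in> sets X" using LD unfolding LD_set_with_def by auto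
  note [measurable_cong] = \<nu>
  note sp = sets_eq_imp_space_eq[OF \<nu>]
  note [measurable] = measurable_g_section[OF Q g y] measurable_prob_algebraD[OF Q]
  define q where "q x = (\<integral>\<^sup>+z\<in>D. ennreal (g z (y 1)) \<partial>Q x)" for x
  define c where "c = (\<integral>\<^sup>+x. ennreal (g x (y 0)) * q x \<partial>\<nu>)"
  have [measurable]: "q \<in> borel_measurable X"
    unfolding q_def[abs_def]
    by (rule measurable_compose[OF measurable_prob_algebraD[OF Q] nn_integral_measurable_subprob_algebra]) measurable
  have meas: "(\<lambda>z. ennreal (g z (y 1)) * indicator D z) \<in> borel_measurable (Q x)" if "x \<in> space X" for x
    unfolding measurable_cong_sets[OF kernel(1)[OF that] refl] by measurable
  \<comment> \<open>As g > 0, a vanishing \<open>c\<close> would force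
    \<open>emeasure (Q x) D = 0\<close> for \<nu>-almost every x, against
    \<open>pos\<close>.\<close>
  have c_pos: "0 < c"
  proof (rule ccontr)
    assume "\<not> 0 < c"
    then have AE_0: "AE x in \<nu>. ennreal (g x (y 0)) * q x = 0"
      unfolding c_def by (subst nn_integral_0_iff_AE[symmetric]) simp_all
    have null: "emeasure (Q x) D = 0" if x: "x \<in> space X" and 0: "ennreal (g x (y 0)) * q x = 0" for x
    proof -
      have "q x = 0" using 0 g_pos[OF x y[of 0]] by auto
      then have "AE z in Q x. ennreal (g z (y 1)) * indicator D z = 0"
        unfolding q_def using meas[OF x] by (simp only: nn_integral_0_iff_AE)
      then have "AE z in Q x. z \<notin> D"
      proof eventually_elim
        case (elim z)
        then show ?case
          using g_pos[of z "y 1"] y sets.sets_into_space[OF D] by (auto simp: indicator_def split: if_splits)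
      qed
      then show ?thesis
        using D kernel[OF x] sets.sets_into_space[OF D] by (subst (asm) AE_iff_measurable[of D]) auto
    qed
    from AE_space[of \<nu>] AE_0 have "AE x in \<nu>. emeasure (Q x) D = 0"
      unfolding sp by eventually_elim (rule null)
    then have "(\<integral>\<^sup>+x. emeasure (Q x) D \<partial>\<nu>) = (\<integral>\<^sup>+x. 0 \<partial>\<nu>)"
      by (rule nn_integral_cong_AE)
    then show False using pos by simp
  qed
  have ge: "c * (\<Prod>i=2..n. ennreal em * Psi g \<Lambda> D (y i)) \<le> path_integral Q g n y (\<lambda>_. 1) \<nu>"
    if n2: "n \<ge> 2" for n
  proof -
    obtain m where "n = 2 + m" using le_Suc_ex[OF n2] by auto
    then have n: "n = Suc (Suc m)" by simp
    let ?p = "\<Prod>i\<le>m. ennreal em * Psi g \<Lambda> D (y (Suc (Suc i)))"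
    have "(\<Prod>i=2..n. ennreal em * Psi g \<Lambda> D (y i)) = ?p"
      using prod.shift_bounds_cl_nat_ivl[of "\<lambda>i. ennreal em * Psi g \<Lambda> D (y i)" 0 2 m]
      by (simp add: n atLeast0AtMost numeral_2_eq_2 del: prod.cl_ivl_Suc)
    then have "c * (\<Prod>i=2..n. ennreal em * Psi g \<Lambda> D (y i)) = (\<integral>\<^sup>+x. ennreal (g x (y 0)) * (q x * ?p) \<partial>\<nu>)"
      unfolding c_def by (simp add: nn_integral_multc mult.assoc[symmetric])
    also have "\<dots> \<le> (\<integral>\<^sup>+x. ennreal (g x (y 0)) *
        (\<integral>\<^sup>+z. ennreal (g z (y 1)) * path_integral Q g m (\<lambda>i. y (Suc (Suc i))) (\<lambda>_. 1) (Q z) \<partial>Q x) \<partial>\<nu>)"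
    proof (intro nn_integral_mono mult_left_mono)
      fix x assume "x \<in> space \<nu>"
      then have x: "x \<in> space X" using sp by simp
      have "q x * ?p = (\<integral>\<^sup>+z. ennreal (g z (y 1)) * indicator D z * ?p \<partial>Q x)"
        unfolding q_def by (rule nn_integral_multc[OF meas[OF x], symmetric])
      also have "\<dots> \<le> (\<integral>\<^sup>+z. ennreal (g z (y 1)) * path_integral Q g m (\<lambda>i. y (Suc (Suc i))) (\<lambda>_. 1) (Q z) \<partial>Q x)"
        using path_integral_ge_LD[OF LD, of _ "\<lambda>i. y (Suc (Suc i))" m] y
        by (intro nn_integral_mono) (auto simp: indicator_def intro: mult_left_mono)
      finally show "q x * ?p \<le> \<dots>" .
    qed simp
    finally show ?thesis by (simp add: n)
  qed
  show thesis
  \<comment> \<open>\<open>c\<close> may be infinite; the minimum with 1 makes it a positive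
    real.\<close>
  proof (rule that[of "enn2real (min c 1)"])
    have fin: "min c 1 < top" by (simp add: min_less_iff_disj)
    then show "0 < enn2real (min c 1)"
      using c_pos by (simp add: enn2real_positive_iff)
    fix n :: nat assume "n \<ge> 2"
    have "ennreal (enn2real (min c 1)) * (\<Prod>i=2..n. ennreal em * Psi g \<Lambda> D (y i)) \<le>
        c * (\<Prod>i=2..n. ennreal em * Psi g \<Lambda> D (y i))"
      using fin by (intro mult_right_mono) simp_all
    then show "ennreal (enn2real (min c 1)) * (\<Prod>i=2..n. ennreal em * Psi g \<Lambda> D (y i)) \<le>
        path_integral Q g n y (\<lambda>_. 1) \<nu>"
      using ge[OF \<open>n \<ge> 2\<close>] by (rule order_trans)
  qed
qed

section \<open>Exponential rates along a fixed trajectory\<close>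

lemma Ups_pos:
  assumes "space X \<noteq> {}" "y \<in> space Y"
  shows "0 < Ups y"
proof -
  obtain x where x: "x \<in> space X" using assms by auto
  have "0 < ennreal (g x y) * QV x"
    using g_pos[OF x assms(2)] less_le_trans[OF zero_less_one QV_ge_1[OF x]] by (simp add: ennreal_zero_less_mult_iff)
  also have "\<dots> \<le> Ups y * ennreal (V x)" using x by (intro drift)
  finally show ?thesis by (auto simp: ennreal_zero_less_mult_iff)
qed

text \<open>With exponent about \<gamma> n / 8, the power of exp(-H) is about exp(-(4 M + 2 |ln em|
  + 1) n). The squared product of Upsilon costs exp(2 M n) and the two normalising constants cost
  exp(2 (M + |ln em|) n); the summand 1 in \<open>H\<close> is what is left as decay rate.\<close>

lemma exponential_forgetting:
  fixes y :: "nat \<Rightarrow> 'y" and \<gamma> M em ep cm cp :: real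
  defines "H \<equiv> 8 / \<gamma> * (4 * M + 2 * \<bar>ln em\<bar> + 1)"
  assumes D: "LD_set_with X Q D \<Lambda> em ep" and C: "LD_set_with X Q C \<Lambda>' cm cp"
    and \<gamma>: "0 < \<gamma>" and M: "0 < M"
    and \<eta>: "\<And>z. z \<in> K \<Longrightarrow> Upsilon Q g V (space X - C) z \<le> ennreal (exp (- H)) * Ups z"
    and y: "\<And>i. y i \<in> space Y"
    and visits: "liminf (\<lambda>n. ereal ((\<Sum>i=0..n. indicator K (y i)) / real n)) \<ge> ereal ((1 + \<gamma>) / 2)"
    and Ups: "limsup (\<lambda>n. (\<Sum>i=0..n. elog (Ups (y i))) / ereal (real n)) < ereal M"
    and Psi: "liminf (\<lambda>n. (\<Sum>i=2..n. elog (Psi g \<Lambda> D (y i))) / ereal (real n)) > ereal (- M)"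
    and \<nu>: "sets \<nu> = sets X" "prob_space \<nu>" "(\<integral>\<^sup>+x. V x \<partial>\<nu>) < \<infinity>" "0 < (\<integral>\<^sup>+x. emeasure (Q x) D \<partial>\<nu>)"
    and \<nu>': "sets \<nu>' = sets X" "prob_space \<nu>'" "(\<integral>\<^sup>+x. V x \<partial>\<nu>') < \<infinity>" "0 < (\<integral>\<^sup>+x. emeasure (Q x) D \<partial>\<nu>')"
  shows "limsup (\<lambda>n. elog (tv_dist (filtering_dist Q g \<nu> n y) (filtering_dist Q g \<nu>' n y)) / ereal (real n))
    \<le> ereal (- min 1 (\<gamma> / 8 * - ln (max (1 - (cm / cp)\<^sup>2) (1 / 2))))"
proof -
  \<comment> \<open>The maximum excludes \<open>\<rho> = 0\<close>, where \<open>ln \<rho>\<close> would be a junk value.\<close>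
  define \<rho> where "\<rho> = max (1 - (cm / cp)\<^sup>2) (1 / 2)"
  define d where "d = min 1 (\<gamma> / 8 * - ln \<rho>)"
  \<comment> \<open>Both exponents are set to this number, so 3 \<open>k n\<close> must fit into the
    roughly \<gamma> n units that the visits outside \<open>K\<close> leave. An eighth leaves room
    for the limit inferior and for additive constants.\<close>
  define k where "k n = nat \<lfloor>\<gamma> * real n / 8\<rfloor>" for n
  have em: "0 < em" and cm: "0 < cm" "0 < cp"
    using D C by (auto simp: LD_set_with_def)
  have \<rho>: "0 < \<rho>" "\<rho> < 1" using cm by (auto simp: \<rho>_def)
  have H: "0 < H" using \<gamma> M unfolding H_def by (intro mult_pos_pos) (auto intro: add_pos_nonneg)
  have k: "real (k n) \<le> \<gamma> * real n / 8" "\<gamma> * real n / 8 - 1 \<le> real (k n)" for n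
    unfolding k_def using \<gamma> of_nat_floor[of "\<gamma> * real n / 8"] by (simp, linarith)
  have X: "space X \<noteq> {}"
    using prob_space.not_empty[OF \<nu>(2)] sets_eq_imp_space_eq[OF \<nu>(1)] by simp
  have Ups_ev: "\<forall>\<^sub>F n in sequentially. (\<Sum>i=0..n. elog (Ups (y i))) / ereal (real n) < ereal M"
    using Ups by (rule Limsup_lessD)
  \<comment> \<open>In \<open>ereal\<close> an infinite term makes all later partial sums infinite,
    whatever the other terms are, against the bound by \<open>M\<close>.\<close>
  have Ups_fin: "Ups (y i) < \<infinity>" for i
  proof (rule ccontr)
    assume "\<not> Ups (y i) < \<infinity>"
    then have inf: "elog (Ups (y i)) = \<infinity>" by (simp add: elog_def less_top)
    obtain n where n: "n \<ge> Suc i" "(\<Sum>i=0..n. elog (Ups (y i))) / ereal (real n) < ereal M"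
      using eventually_conj[OF eventually_ge_at_top Ups_ev] by (metis (no_types, lifting) eventually_happens' sequentially_bot)
    then have "(\<Sum>i=0..n. elog (Ups (y i))) = \<infinity>"
      using inf by (subst sum_Pinfty) auto
    then show False using n by simp
  qed
  have Ups_prod: "\<forall>\<^sub>F n in sequentially. (\<Prod>i\<le>n. Ups (y i)) \<le> ennreal (exp (M * real n))"
    using Ups_ev eventually_gt_at_top[of 0]
  proof eventually_elim
    case (elim n)
    have *: "0 < Ups (y i) \<and> Ups (y i) < top" for i using Ups_pos[OF X y] Ups_fin by simp
    show ?case
      using elim elog_prod[of "{0..n}" "\<lambda>i. Ups (y i)"] * elog_divide_less_imp
      by (simp add: atLeast0AtMost)
  qed
  have Psi_prod: "\<forall>\<^sub>F n in sequentially. ennreal (exp (- M * real n)) \<le> (\<Prod>i=2..n. Psi g \<Lambda> D (y i))"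
    using less_LiminfD[OF Psi] eventually_gt_at_top[of 0]
  proof eventually_elim
    case (elim n)
    have *: "0 < Psi g \<Lambda> D (y i) \<and> Psi g \<Lambda> D (y i) < top" for i
      using Psi_bounds[OF D y] Ups_fin by simp
    show ?case
      using elim elog_prod[of "{2..n}" "\<lambda>i. Psi g \<Lambda> D (y i)"] * elog_divide_greater_imp[of "- M"]
      by simp
  qed
  \<comment> \<open>A value strictly below (1 + \<gamma>) / 2. Twice the number of times outside
    \<open>K\<close> is then less than n + 2 - 3 \<gamma> n / 4, where the 2 stems from having n + 1
    observations. Adding 3 \<gamma> n / 8 leaves the condition 2 \<le> 3 \<gamma> n / 8, hence the
    threshold 16 / (3 \<gamma>).\<close>
  have "ereal ((4 + 3 * \<gamma>) / 8) < liminf (\<lambda>n. ereal ((\<Sum>i=0..n. indicator K (y i)) / real n))"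
    using \<gamma> by (intro less_le_trans[OF _ visits]) (simp add: field_simps)
  from less_LiminfD[OF this]
  have budget: "\<forall>\<^sub>F n in sequentially. k n + 2 * k n + 2 * (\<Sum>i\<le>n. if y i \<in> K then 0 else 1) \<le> n"
    using eventually_ge_at_top[of "nat \<lceil>16 / (3 * \<gamma>)\<rceil>"] eventually_gt_at_top[of 0]
  proof eventually_elim
    case (elim n)
    have "(\<Sum>i\<le>n. if y i \<in> K then 0 else 1 :: real) = (\<Sum>i\<le>n. 1 - indicator K (y i))"
      by (intro sum.cong) (auto simp: indicator_def)
    also have "\<dots> = real n + 1 - (\<Sum>i=0..n. indicator K (y i))"
      by (simp add: sum_subtractf atLeast0AtMost)
    finally have compl: "(\<Sum>i\<le>n. if y i \<in> K then 0 else 1 :: real) = real n + 1 - (\<Sum>i=0..n. indicator K (y i))" .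
    have "((4 + 3 * \<gamma>) / 8) * real n < (\<Sum>i=0..n. indicator K (y i))"
      using elim by (simp add: pos_less_divide_eq)
    moreover have "16 / (3 * \<gamma>) \<le> real n"
      using elim by linarith
    then have "2 \<le> 3 * \<gamma> / 8 * real n"
      using \<gamma> by (simp add: field_simps)
    ultimately have "3 * real (k n) + 2 * (\<Sum>i\<le>n. if y i \<in> K then 0 else 1 :: real) \<le> real n"
      unfolding compl using k(1)[of n] by (simp add: algebra_simps)
    also have "(\<Sum>i\<le>n. if y i \<in> K then 0 else 1 :: real) = real (\<Sum>i\<le>n. if y i \<in> K then 0 else 1)"
      by (simp add: of_nat_sum if_distrib cong: if_cong)
    finally show ?case by linarith
  qed
  obtain c where c: "0 < c" "\<And>n. n \<ge> 2 \<Longrightarrow>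
      ennreal c * (\<Prod>i=2..n. ennreal em * Psi g \<Lambda> D (y i)) \<le> path_integral Q g n y (\<lambda>_. 1) \<nu>"
    by (rule path_integral_ge[where y=y, OF D y \<nu>(1,4)]) (rule that)
  obtain c' where c': "0 < c'" "\<And>n. n \<ge> 2 \<Longrightarrow>
      ennreal c' * (\<Prod>i=2..n. ennreal em * Psi g \<Lambda> D (y i)) \<le> path_integral Q g n y (\<lambda>_. 1) \<nu>'"
    by (rule path_integral_ge[where y=y, OF D y \<nu>'(1,4)]) (rule that)
  obtain v where v: "(\<integral>\<^sup>+x. V x \<partial>\<nu>) = ennreal v" "0 \<le> v"
    using \<nu>(3) by (cases "\<integral>\<^sup>+x. V x \<partial>\<nu>") auto
  obtain v' where v': "(\<integral>\<^sup>+x. V x \<partial>\<nu>') = ennreal v'" "0 \<le> v'"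
    using \<nu>'(3) by (cases "\<integral>\<^sup>+x. V x \<partial>\<nu>'") auto
  \<comment> \<open>The floor in \<open>k n\<close> loses at most one factor, which costs
    \<open>1 / \<rho>\<close> in one term and \<open>exp H\<close> in the other. The remaining
    constants may depend on the trajectory, but not on n.\<close>
  define B where "B = 1 / \<rho> + exp H * (v * v') / (c * c')"
  have B: "0 < B" unfolding B_def using \<rho> v v' c c' by (intro add_pos_nonneg) auto
  have "\<forall>\<^sub>F n in sequentially. tv_dist (filtering_dist Q g \<nu> n y) (filtering_dist Q g \<nu>' n y)
      \<le> ennreal (B * exp (- d * real n))"
    using Ups_prod Psi_prod budget eventually_ge_at_top[of 2]
  proof eventually_elim
    case (elim n)
    let ?N = "path_integral Q g n y (\<lambda>_. 1)"
    \<comment> \<open>Both normalising constants are at least a constant times exp(-l):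
      \<open>\<bar>ln em\<bar>\<close> pays for the n - 1 factors \<open>em\<close>, which may be
      below or above 1, and \<open>M\<close> for the product of \<open>Psi\<close>.\<close>
    define l where "l = (\<bar>ln em\<bar> + M) * real n"
    have "ennreal (exp (- (\<bar>ln em\<bar> * real n))) \<le> ennreal (em ^ (n - 1))"
    proof (rule ennreal_leI)
      have "- (\<bar>ln em\<bar> * real n) \<le> - (\<bar>ln em\<bar> * real (n - 1))"
        by (simp add: mult_left_mono)
      also have "\<dots> \<le> real (n - 1) * ln em"
        using mult_left_mono[of "- \<bar>ln em\<bar>" "ln em" "real (n - 1)"] by (simp add: mult.commute)
      finally show "exp (- (\<bar>ln em\<bar> * real n)) \<le> em ^ (n - 1)"
        using em by (metis exp_le_cancel_iff exp_of_nat_mult exp_ln)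
    qed
    then have "ennreal (exp (- (\<bar>ln em\<bar> * real n))) * ennreal (exp (- M * real n)) \<le>
        ennreal (em ^ (n - 1)) * (\<Prod>i=2..n. Psi g \<Lambda> D (y i))"
      using elim by (intro mult_mono) auto
    also have "\<dots> = (\<Prod>i=2..n. ennreal em * Psi g \<Lambda> D (y i))"
      using em by (simp add: prod.distrib ennreal_power)
    finally have low: "ennreal (exp (- l)) \<le> (\<Prod>i=2..n. ennreal em * Psi g \<Lambda> D (y i))"
      by (simp add: l_def algebra_simps exp_add[symmetric] ennreal_mult[symmetric])
    have N: "ennreal (c * exp (- l)) \<le> ?N \<nu>" "ennreal (c' * exp (- l)) \<le> ?N \<nu>'"
      using c c' elim mult_left_mono[OF low, of "ennreal c"] mult_left_mono[OF low, of "ennreal c'"]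
      by (auto simp: ennreal_mult intro: order_trans)
    have NN: "ennreal ((c * exp (- l)) * (c' * exp (- l))) \<le> ?N \<nu> * ?N \<nu>'"
      using mult_mono[OF N] c c' by (simp add: ennreal_mult)
    have N_pos: "0 < ?N \<nu>" "0 < ?N \<nu>'"
      using c c' by (auto intro!: less_le_trans[OF _ N(1)] less_le_trans[OF _ N(2)])
    have "tv_dist (filtering_dist Q g \<nu> n y) (filtering_dist Q g \<nu>' n y) \<le>
        ennreal (1 - (cm / cp)\<^sup>2) ^ k n + ennreal (exp (- H)) ^ k n *
          ((\<Prod>i\<le>n. Ups (y i))\<^sup>2 * ((\<integral>\<^sup>+x. V x \<partial>\<nu>) * (\<integral>\<^sup>+x. V x \<partial>\<nu>'))) / (?N \<nu> * ?N \<nu>')"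
      using \<eta> by (intro tv_dist_filtering_le[OF C _ _ y Ups_fin elim(3) \<nu>(1-3) \<nu>'(1-3) N_pos]) auto
    also have "\<dots> \<le> ennreal (\<rho> ^ k n) + ennreal (exp (- H) ^ k n * ((exp (M * real n))\<^sup>2 * (v * v'))) /
        ennreal ((c * exp (- l)) * (c' * exp (- l)))"
    proof (intro add_mono)
      show "ennreal (1 - (cm / cp)\<^sup>2) ^ k n \<le> ennreal (\<rho> ^ k n)"
        using \<rho> by (subst ennreal_power[symmetric]) (auto intro!: power_mono ennreal_leI simp: \<rho>_def)
      have "ennreal (exp (- H)) ^ k n * ((\<Prod>i\<le>n. Ups (y i))\<^sup>2 * ((\<integral>\<^sup>+x. V x \<partial>\<nu>) * (\<integral>\<^sup>+x. V x \<partial>\<nu>'))) \<le>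
          ennreal (exp (- H)) ^ k n * ((ennreal (exp (M * real n)))\<^sup>2 * (ennreal v * ennreal v'))"
        unfolding v(1) v'(1) using elim(1) by (intro mult_left_mono mult_right_mono power_mono) auto
      also have "\<dots> = ennreal (exp (- H) ^ k n * ((exp (M * real n))\<^sup>2 * (v * v')))"
        using v v' by (simp add: ennreal_mult ennreal_power)
      finally show "ennreal (exp (- H)) ^ k n *
          ((\<Prod>i\<le>n. Ups (y i))\<^sup>2 * ((\<integral>\<^sup>+x. V x \<partial>\<nu>) * (\<integral>\<^sup>+x. V x \<partial>\<nu>'))) / (?N \<nu> * ?N \<nu>') \<le>
          ennreal (exp (- H) ^ k n * ((exp (M * real n))\<^sup>2 * (v * v'))) /
          ennreal ((c * exp (- l)) * (c' * exp (- l)))"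
        using NN unfolding divide_ennreal_def by (intro mult_mono ennreal_inverse_antimono) auto
    qed
    also have "\<dots> = ennreal (\<rho> ^ k n + exp (- H) ^ k n * ((exp (M * real n))\<^sup>2 * (v * v')) /
        ((c * exp (- l)) * (c' * exp (- l))))"
      using \<rho> v v' c c' by (simp add: divide_ennreal)
    also have "\<dots> \<le> ennreal (B * exp (- d * real n))"
    proof (rule ennreal_leI)
      have "\<rho> ^ k n = exp (real (k n) * ln \<rho>)"
        using \<rho> by (simp add: exp_of_nat_mult)
      also have "\<dots> \<le> exp ((\<gamma> * real n / 8 - 1) * ln \<rho>)"
        using k(2)[of n] \<rho> by (simp add: mult_right_mono_neg)
      also have "\<dots> = 1 / \<rho> * exp (- (\<gamma> / 8 * - ln \<rho>) * real n)"
        using \<rho> by (simp add: left_diff_distrib exp_diff algebra_simps)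
      also have "\<dots> \<le> 1 / \<rho> * exp (- d * real n)"
      proof -
        have "d * real n \<le> (\<gamma> / 8 * - ln \<rho>) * real n"
          unfolding d_def by (intro mult_right_mono min.cobounded2) simp
        then show ?thesis using \<rho> by (intro mult_left_mono) simp_all
      qed
      finally have 1: "\<rho> ^ k n \<le> 1 / \<rho> * exp (- d * real n)" .
      have Hk: "- (H * real (k n)) \<le> H - (4 * M + 2 * \<bar>ln em\<bar> + 1) * real n"
      proof -
        have "H * (\<gamma> * real n / 8 - 1) \<le> H * real (k n)"
          using H k(2) by (intro mult_left_mono) auto
        moreover have "H * \<gamma> = 8 * (4 * M + 2 * \<bar>ln em\<bar> + 1)"
          using \<gamma> by (simp add: H_def)
        then have "H * (\<gamma> * real n / 8 - 1) = (4 * M + 2 * \<bar>ln em\<bar> + 1) * real n - H"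
          by (simp add: right_diff_distrib mult.assoc[symmetric])
        ultimately show ?thesis by linarith
      qed
      have "exp (- H) ^ k n * (exp (M * real n))\<^sup>2 / (exp (- l) * exp (- l)) =
          exp (- (H * real (k n)) + 2 * (M * real n) + 2 * l)"
        by (simp add: exp_of_nat_mult[symmetric] exp_add[symmetric] exp_diff[symmetric] power2_eq_square algebra_simps)
      also have "\<dots> \<le> exp (H + - d * real n)"
      proof -
        have "d * real n \<le> 1 * real n" by (intro mult_right_mono) (auto simp: d_def)
        then show ?thesis using Hk by (simp add: l_def algebra_simps)
      qed
      finally have 2: "exp (- H) ^ k n * (exp (M * real n))\<^sup>2 / (exp (- l) * exp (- l)) \<le> exp H * exp (- d * real n)"
        by (simp only: exp_add)
      have "exp (- H) ^ k n * ((exp (M * real n))\<^sup>2 * (v * v')) / ((c * exp (- l)) * (c' * exp (- l))) =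
          exp (- H) ^ k n * (exp (M * real n))\<^sup>2 / (exp (- l) * exp (- l)) * ((v * v') / (c * c'))"
        by (simp add: ac_simps)
      also have "\<dots> \<le> exp H * exp (- d * real n) * ((v * v') / (c * c'))"
        using v v' c c' by (intro mult_right_mono 2) auto
      finally show "\<rho> ^ k n + exp (- H) ^ k n * ((exp (M * real n))\<^sup>2 * (v * v')) /
          ((c * exp (- l)) * (c' * exp (- l))) \<le> B * exp (- d * real n)"
        using 1 unfolding B_def by (simp add: distrib_right algebra_simps)
    qed
    finally show ?case .
  qed
  then show ?thesis
    unfolding \<rho>_def[symmetric] d_def[symmetric] by (rule limsup_elog_le[OF B])
qed

end

theorem theorem1:
  fixes X :: "'x measure" and Y :: "'y measure" and \<mu> :: "'y measure"
    and Q :: "'x \<Rightarrow> 'x measure" and G :: "'x \<Rightarrow> 'y measure" and g :: "'x \<Rightarrow> 'y \<Rightarrow> real"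
    and P :: "'w measure" and Yp :: "nat \<Rightarrow> 'w \<Rightarrow> 'y"
    and K :: "'y set" and V :: "'x \<Rightarrow> real"
    and D :: "'x set" and \<Lambda>\<^sub>D :: "'x measure" and \<epsilon>m \<epsilon>p M \<gamma> :: real
    and \<nu> \<nu>' :: "'x measure"
  assumes "countably_generated X" and "countably_generated Y"
    and "Q \<in> measurable X (prob_algebra X)"
    and "transition_kernel X Y G"
    and "sets \<mu> = sets Y"
    and "\<And>x. x \<in> space X \<Longrightarrow> absolutely_continuous \<mu> (G x)"
    and "case_prod g \<in> borel_measurable (X \<Otimes>\<^sub>M Y)"
    and "\<And>x. x \<in> space X \<Longrightarrow> G x = density \<mu> (\<lambda>y. ennreal (g x y))"
    and "prob_space P"
    and "\<And>k. Yp k \<in> measurable P Y"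
    and "\<And>x y. x \<in> space X \<Longrightarrow> y \<in> space Y \<Longrightarrow> g x y > 0"
    and "K \<subseteq> space Y"
    and "V \<in> borel_measurable X"
    and "\<And>x. x \<in> space X \<Longrightarrow> V x \<ge> 1"
    and "\<And>\<eta>::real. \<eta> > 0 \<Longrightarrow>
           \<exists>C. LD_set X Q C \<and>
             (\<forall>y\<in>K. Upsilon Q g V (space X - C) y \<le> ennreal \<eta> * Upsilon Q g V (space X) y)"
    and "LD_set_with X Q D \<Lambda>\<^sub>D \<epsilon>m \<epsilon>p"
    and "M > 0" and "0 < \<gamma>" and "\<gamma> < 1"
    and "AE \<omega> in P. liminf (\<lambda>n. ereal ((\<Sum>i=0..n. indicator K (Yp i \<omega>)) / real n))
                       \<ge> ereal ((1 + \<gamma>) / 2)"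
    and "AE \<omega> in P. limsup (\<lambda>n. (\<Sum>i=0..n. elog (Upsilon Q g V (space X) (Yp i \<omega>))) / ereal (real n))
                       < ereal M"
    and "AE \<omega> in P. liminf (\<lambda>n. (\<Sum>i=2..n. elog (Psi g \<Lambda>\<^sub>D D (Yp i \<omega>))) / ereal (real n))
                       > ereal (- M)"
    and "prob_space \<nu>" and "sets \<nu> = sets X"
    and "prob_space \<nu>'" and "sets \<nu>' = sets X"
    and "(\<integral>\<^sup>+ x. ennreal (V x) \<partial>\<nu>) + (\<integral>\<^sup>+ x. ennreal (V x) \<partial>\<nu>') < \<infinity>"
    and "(\<integral>\<^sup>+ x. emeasure (Q x) D \<partial>\<nu>) > 0"
    and "(\<integral>\<^sup>+ x. emeasure (Q x) D \<partial>\<nu>') > 0"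
  shows "\<exists>c::real. c > 0 \<and>
    (AE \<omega> in P.
       limsup (\<lambda>n. elog (tv_dist (filtering_dist Q g \<nu> n (\<lambda>i. Yp i \<omega>))
                                 (filtering_dist Q g \<nu>' n (\<lambda>i. Yp i \<omega>))) / ereal (real n))
         < ereal (- c))"
proof -
  interpret drift_model X Y Q g V
    using assms(3,7,11,13,14) by unfold_locales auto
  define H where "H = 8 / \<gamma> * (4 * M + 2 * \<bar>ln \<epsilon>m\<bar> + 1)"
  obtain C \<Lambda>C cm cp where C: "LD_set_with X Q C \<Lambda>C cm cp"
    and drift_C: "\<And>y. y \<in> K \<Longrightarrow> Upsilon Q g V (space X - C) y \<le> ennreal (exp (- H)) * Ups y"
    using assms(15)[of "exp (- H)"] unfolding LD_set_def by auto
  have cm: "0 < cm" "0 < cp"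
    using C by (auto simp: LD_set_with_def)
  define d where "d = min 1 (\<gamma> / 8 * - ln (max (1 - (cm / cp)\<^sup>2) (1 / 2)))"
  have "max (1 - (cm / cp)\<^sup>2) (1 / 2) < 1" "0 < max (1 - (cm / cp)\<^sup>2) (1 / 2)"
    using cm by auto
  then have d: "0 < d"
    using \<open>0 < \<gamma>\<close> by (simp add: d_def mult_pos_neg)
  have V_fin: "(\<integral>\<^sup>+ x. ennreal (V x) \<partial>\<nu>) < \<infinity>" "(\<integral>\<^sup>+ x. ennreal (V x) \<partial>\<nu>') < \<infinity>"
    using assms(27) by auto
  \<comment> \<open>The rate \<open>d\<close> is the same for all trajectories; halving it makes the
    inequality strict.\<close>
  have "AE \<omega> in P. limsup (\<lambda>n. elog (tv_dist (filtering_dist Q g \<nu> n (\<lambda>i. Yp i \<omega>))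
      (filtering_dist Q g \<nu>' n (\<lambda>i. Yp i \<omega>))) / ereal (real n)) < ereal (- (d / 2))"
    using assms(20-22) AE_space
  proof eventually_elim
    case (elim \<omega>)
    have "Yp i \<omega> \<in> space Y" for i
      using measurable_space[OF assms(10) elim(4)] .
    then have "limsup (\<lambda>n. elog (tv_dist (filtering_dist Q g \<nu> n (\<lambda>i. Yp i \<omega>))
      (filtering_dist Q g \<nu>' n (\<lambda>i. Yp i \<omega>))) / ereal (real n)) \<le> ereal (- d)"
      unfolding d_def
      by (intro exponential_forgetting[OF assms(16) C \<open>0 < \<gamma>\<close> \<open>M > 0\<close> drift_C[unfolded H_def] _ elim(1-3)
            assms(24,23) V_fin(1) assms(28) assms(26,25) V_fin(2) assms(29)])
    also have "ereal (- d) < ereal (- (d / 2))"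
      using d by simp
    finally show ?case .
  qed
  then show ?thesis
    using d by (intro exI[of _ "d / 2"]) simp
qed

end
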